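(* Suppose that: (i) $\sup_{k\ge1}\|\psi_k\|_\infty<\infty$; (ii) there are $\lambda\in\mathbb R$ and $K_0>0$, independent of $n$ and $p$, such that for all $n,p$ the matrix $\Psi\in\mathbb R^{p\times p}$, $\Psi_{k\ell}=\sum_{j=1}^n\psi_k(j/n)\psi_\ell(j/n)$, satisfies $|u^\top(\Psi-nI_p)u|\le K_0\sum_{k=1}^pk^\lambda u_k^2$ for all $u\in\mathbb R^p$; (iii) $\|\mathcal Rq_{\hat\theta}\|_\infty\le C_0$ for a constant $C_0$ independent of $n$ and $p$; (iv) $\|h'''\|_\infty=\sup_{t\in\mathbb R}|h'''(t)|<\infty$. Let $m=n^{1/(2\beta+2\gamma)}$, $\gamma_0^*=\gamma-\frac12-\frac1{2m}$, $m_0^*=n^{1/(2\beta+2\gamma_0^* )}$. Suppose $\beta>1/2$, $\gamma>1/2$, and $2\beta+2\gamma>\max(2,\lambda+1)$. Then for all $n$ large enough, $$\mathtt p(\mathbb D(\gamma_0^* ))\asymp m\wedge p,\qquad \|\nabla^3f\|_{\mathbb D(\gamma_0^* ),\infty}\lesssim\sqrt{\frac{m_0^*\wedge p}{n}},$$ $$\mathtt p(\mathbb D_G)=p,\qquad \|\nabla^3f\|_{\mathbb D_G,\infty}\lesssim\sqrt{\frac{m\wedge p}{n}},$$ $$\mathtt p(I_p/\alpha(I_p))\asymp m\wedge p,\qquad \|\nabla^3f\|_{I_p/\alpha(I_p),\infty}\lesssim\sqrt{\frac{(m\wedge p)^{6\beta}}{n}}.$$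
   Context: Operator. $\mathcal R:E\to L^2[0,1]$ is a compact linear operator, $E$ a linear subspace of $L^2[0,1]$; $\phi_k$, $k\ge1$, is a complete orthonormal basis of $E$ of eigenfunctions of $\mathcal R^\top\mathcal R$ with eigenvalues $\lambda_1\ge\lambda_2\ge\dots>0$ satisfying $c'k^{-2\beta}\le\lambda_k\le C'k^{-2\beta}$ for all $k$ (constants $0<c'<C'$, $\beta\ge0$). Put $\psi_k=\mathcal R\phi_k/\sqrt{\lambda_k}$ (orthonormal in $L^2[0,1]$); these functions are taken to be defined pointwise on $[0,1]$, and $\|\cdot\|_\infty$ for functions on $[0,1]$ is the sup norm. Exponential family. $\rho(dy\mid s)=\exp(sy-h(s))\mu(dy)$, $y\in\mathcal Y\subset\mathbb R$, with $h(s)=\log\int e^{sy}\mu(dy)$ finite for all $s\in\mathbb R$; $h$ is infinitely differentiable and strictly convex with $h''>0$. Posterior. Given integers $n,p\ge1$ and data $Y_1,\dots,Y_n\in\mathcal Y$, for $\theta\in\mathbb R^p$ let $q_\theta=\sum_{k=1}^p\theta_k\phi_k$ and let $R\in\mathbb R^{n\times p}$, $R_{jk}=(\mathcal R\phi_k)(j/n)$, with rows $R_j^\top$. Let $L(\theta)=\sum_{j=1}^n[h(R_j^\top\theta)-Y_jR_j^\top\theta]$, $G^2=\mathrm{diag}(k^{2\gamma})_{k=1}^p$ with $\gamma\ge0$, and $f(\theta)=L(\theta)+\frac12\|G\theta\|^2$, which is strongly convex with unique minimizer $\hat\theta$. Matrices. $\mathbb D_G\succ0$ is the symmetric square root of $\nabla^2f(\hat\theta)$.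 For $\gamma_0\le\gamma$, $\mathbb D(\gamma_0)\succ0$ is symmetric with $\mathbb D(\gamma_0)^2=\nabla^2L(\hat\theta)+\mathrm{diag}(k^{2\gamma_0})_{k=1}^p$. For symmetric $\mathbb D\succ0$: $\alpha(\mathbb D)=\|\mathbb D_G^{-1}\mathbb D\|$, $\mathtt p(\mathbb D)=\mathrm{Tr}(\mathbb D_G^{-2}\mathbb D^2)/\alpha(\mathbb D)^2$, and $\|\nabla^3f\|_{\mathbb D,\infty}=\sup_{\theta\in\mathbb R^p}\|\nabla^3f(\theta)\|_{\mathbb D}$, where $\|T\|_{\mathbb D}=\sup_{\|\mathbb Du\|=\|\mathbb Dv\|=\|\mathbb Dw\|=1}\langle T,u\otimes v\otimes w\rangle$. Notation. $x\wedge y=\min(x,y)$. $x\lesssim y$ means $x\le Ky$, and $x\asymp y$ means $K^{-1}y\le x\le Ky$, with $K$ depending only on the problem parameters: the operator $\mathcal R$ (hence $\beta,c',C',\phi_k,\psi_k$), $h$, $\gamma$, $\lambda$, $K_0$, $C_0$, $\sup_k\|\psi_k\|_\infty$; not on $n$, $p$ or the data. "For all $n$ large enough" means for $n\ge n_0$ with $n_0$ depending only on these problem parameters. *)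

theory Defs
  imports
    "HOL-Analysis.Analysis"
    "Jordan_Normal_Form.Matrix"
    "Jordan_Normal_Form.Gauss_Jordan_Elimination"
begin

unbundle no vec_syntax
hide_type (open) Finite_Cartesian_Product.vec
hide_const (open) Finite_Cartesian_Product.vec Finite_Cartesian_Product.row
  Determinants.trace

subsection \<open>The space of square integrable functions on the unit interval\<close>

text \<open>Elements of the space are represented by functions (not by classes modulo null sets),
  because the images under the operator are evaluated at points. The values outside the unit
  interval are irrelevant.\<close>

definition L2 :: "(real \<Rightarrow> real) set" where
  "L2 = {f. f \<in> borel_measurable (lebesgue_on {0..1}) \<and>
            integrable (lebesgue_on {0..1}) (\<lambda>x. (f x)\<^sup>2)}"

definition L2_inner :: "(real \<Rightarrow> real) \<Rightarrow> (real \<Rightarrow> real) \<Rightarrow> real" where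
  "L2_inner f g = (LINT x|lebesgue_on {0..1}. f x * g x)"

definition L2_norm :: "(real \<Rightarrow> real) \<Rightarrow> real" where
  "L2_norm f = sqrt (L2_inner f f)"

definition L2_subspace :: "(real \<Rightarrow> real) set \<Rightarrow> bool" where
  "L2_subspace E \<longleftrightarrow> E \<subseteq> L2 \<and> (\<lambda>x. 0) \<in> E \<and>
     (\<forall>f\<in>E. \<forall>g\<in>E. (\<lambda>x. f x + g x) \<in> E) \<and>
     (\<forall>f\<in>E. \<forall>c. (\<lambda>x. c * f x) \<in> E)"

definition L2_closure :: "(real \<Rightarrow> real) set \<Rightarrow> (real \<Rightarrow> real) set" where
  "L2_closure E = {g \<in> L2. \<forall>e>0. \<exists>f\<in>E. L2_norm (\<lambda>x. g x - f x) < e}"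

text \<open>Linearity is required pointwise on the unit interval. Every linear operator between spaces
  of classes has representatives with this property, with the representatives of the images of
  any given linearly independent family prescribed arbitrarily. Compactness makes the
  operator bounded, hence compatible with almost everywhere equality.\<close>

definition L2_linear_op ::
  "(real \<Rightarrow> real) set \<Rightarrow> ((real \<Rightarrow> real) \<Rightarrow> real \<Rightarrow> real) \<Rightarrow> bool" where
  "L2_linear_op E R \<longleftrightarrow> (\<forall>f\<in>E. R f \<in> L2) \<and>
     (\<forall>f\<in>E. \<forall>g\<in>E. \<forall>x\<in>{0..1}. R (\<lambda>y. f y + g y) x = R f x + R g x) \<and>
     (\<forall>f\<in>E. \<forall>c. \<forall>x\<in>{0..1}. R (\<lambda>y. c * f y) x = c * R f x)"

definition L2_compact_op ::
  "(real \<Rightarrow> real) set \<Rightarrow> ((real \<Rightarrow> real) \<Rightarrow> real \<Rightarrow> real) \<Rightarrow> bool" where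
  "L2_compact_op E R \<longleftrightarrow> L2_linear_op E R \<and>
     (\<forall>F :: nat \<Rightarrow> real \<Rightarrow> real. \<forall>B. (\<forall>i. F i \<in> E \<and> L2_norm (F i) \<le> B) \<longrightarrow>
        (\<exists>g\<in>L2. \<exists>r :: nat \<Rightarrow> nat. strict_mono r \<and>
           (\<lambda>i. L2_norm (\<lambda>x. R (F (r i)) x - g x)) \<longlonglongrightarrow> 0))"

text \<open>Since \<open>E\<close> need not be closed, the adjoint takes its values in the closure of \<open>E\<close>.\<close>

definition L2_adjoint ::
  "(real \<Rightarrow> real) set \<Rightarrow> ((real \<Rightarrow> real) \<Rightarrow> real \<Rightarrow> real) \<Rightarrow>
   ((real \<Rightarrow> real) \<Rightarrow> real \<Rightarrow> real) \<Rightarrow> bool" where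
  "L2_adjoint E R Rt \<longleftrightarrow>
     (\<forall>g\<in>L2. Rt g \<in> L2_closure E \<and> (\<forall>f\<in>E. L2_inner (R f) g = L2_inner f (Rt g)))"

text \<open>Sequences of functions and of eigenvalues are indexed by \<open>k \<ge> 1\<close>; the value at \<open>0\<close> is
  irrelevant.\<close>

definition L2_complete_onb :: "(real \<Rightarrow> real) set \<Rightarrow> (nat \<Rightarrow> real \<Rightarrow> real) \<Rightarrow> bool" where
  "L2_complete_onb E \<phi> \<longleftrightarrow> (\<forall>k\<ge>1. \<phi> k \<in> E) \<and>
     (\<forall>k\<ge>1. \<forall>l\<ge>1. L2_inner (\<phi> k) (\<phi> l) = (if k = l then 1 else 0)) \<and>
     (\<forall>f\<in>E. (\<lambda>N. L2_norm (\<lambda>x. f x - (\<Sum>k=1..N. L2_inner f (\<phi> k) * \<phi> k x))) \<longlonglongrightarrow> 0)"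

definition L2_eigenfunction ::
  "((real \<Rightarrow> real) \<Rightarrow> real \<Rightarrow> real) \<Rightarrow> real \<Rightarrow> (real \<Rightarrow> real) \<Rightarrow> bool" where
  "L2_eigenfunction T c f \<longleftrightarrow> \<not> (AE x in lebesgue_on {0..1}. f x = 0) \<and>
     (AE x in lebesgue_on {0..1}. T f x = c * f x)"

definition psi ::
  "((real \<Rightarrow> real) \<Rightarrow> real \<Rightarrow> real) \<Rightarrow> (nat \<Rightarrow> real \<Rightarrow> real) \<Rightarrow> (nat \<Rightarrow> real) \<Rightarrow>
   nat \<Rightarrow> real \<Rightarrow> real" where
  "psi R \<phi> ev k = (\<lambda>x. R (\<phi> k) x / sqrt (ev k))"

definition sup_norm_on :: "real set \<Rightarrow> (real \<Rightarrow> real) \<Rightarrow> ereal" where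
  "sup_norm_on S f = (SUP x\<in>S. ereal \<bar>f x\<bar>)"

subsection \<open>Exponential families\<close>

definition log_partition :: "real measure \<Rightarrow> real \<Rightarrow> real" where
  "log_partition \<mu> s = ln (LINT y|\<mu>. exp (s * y))"

definition exponential_family :: "real set \<Rightarrow> real measure \<Rightarrow> (real \<Rightarrow> real) \<Rightarrow> bool" where
  "exponential_family \<Y> \<mu> h \<longleftrightarrow>
     sets \<mu> = sets (restrict_space borel \<Y>) \<and>
     (\<forall>s. integrable \<mu> (\<lambda>y. exp (s * y)) \<and> (LINT y|\<mu>. exp (s * y)) > 0) \<and>
     h = log_partition \<mu> \<and>
     (\<forall>k s. (deriv ^^ k) h differentiable (at s)) \<and>
     (\<forall>s t u. s \<noteq> t \<longrightarrow> 0 < u \<longrightarrow> u < 1 \<longrightarrow>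
        h (u * s + (1 - u) * t) < u * h s + (1 - u) * h t) \<and>
     (\<forall>s. (deriv ^^ 2) h s > 0)"

subsection \<open>Vectors and matrices\<close>

definition vnorm :: "real vec \<Rightarrow> real" where
  "vnorm v = sqrt (v \<bullet> v)"

definition op_norm :: "real mat \<Rightarrow> real" where
  "op_norm A = (SUP v\<in>{v \<in> carrier_vec (dim_col A). vnorm v = 1}. vnorm (A *\<^sub>v v))"

definition trace :: "real mat \<Rightarrow> real" where
  "trace A = (\<Sum>i<dim_row A. A $$ (i, i))"

text \<open>Unspecified for singular matrices.\<close>

definition mat_inv :: "real mat \<Rightarrow> real mat" where
  "mat_inv A = the (mat_inverse A)"

definition sym_pos_def :: "nat \<Rightarrow> real mat \<Rightarrow> bool" where
  "sym_pos_def p A \<longleftrightarrow> A \<in> carrier_mat p p \<and> transpose_mat A = A \<and>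
     (\<forall>v\<in>carrier_vec p. v \<noteq> 0\<^sub>v p \<longrightarrow> v \<bullet> (A *\<^sub>v v) > 0)"

text \<open>Vectors and matrices are indexed from \<open>0\<close>, so index \<open>k\<close> here is index \<open>k + 1\<close> in the
  mathematical notation.\<close>

definition diag_powr :: "nat \<Rightarrow> real \<Rightarrow> real mat" where
  "diag_powr p s = mat_diag p (\<lambda>k. real (Suc k) powr s)"

subsection \<open>Derivatives of functions of a vector\<close>

definition partial_deriv :: "nat \<Rightarrow> (real vec \<Rightarrow> real) \<Rightarrow> real vec \<Rightarrow> real" where
  "partial_deriv i F \<theta> = deriv (\<lambda>t. F (\<theta> + t \<cdot>\<^sub>v unit_vec (dim_vec \<theta>) i)) 0"

definition hessian :: "(real vec \<Rightarrow> real) \<Rightarrow> real vec \<Rightarrow> real mat" where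
  "hessian F \<theta> = mat (dim_vec \<theta>) (dim_vec \<theta>)
     (\<lambda>(a, b). partial_deriv a (partial_deriv b F) \<theta>)"

definition deriv3 ::
  "(real vec \<Rightarrow> real) \<Rightarrow> real vec \<Rightarrow> real vec \<Rightarrow> real vec \<Rightarrow> real vec \<Rightarrow> real" where
  "deriv3 F \<theta> u v w = (\<Sum>a<dim_vec \<theta>. \<Sum>b<dim_vec \<theta>. \<Sum>c<dim_vec \<theta>.
     partial_deriv a (partial_deriv b (partial_deriv c F)) \<theta> * (u $ a * v $ b * w $ c))"

definition deriv3_norm :: "real mat \<Rightarrow> (real vec \<Rightarrow> real) \<Rightarrow> real vec \<Rightarrow> ereal" where
  "deriv3_norm D F \<theta> =
     (SUP (u, v, w) \<in> {(u, v, w). u \<in> carrier_vec (dim_vec \<theta>) \<and> v \<in> carrier_vec (dim_vec \<theta>) \<and>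
          w \<in> carrier_vec (dim_vec \<theta>) \<and>
          vnorm (D *\<^sub>v u) = 1 \<and> vnorm (D *\<^sub>v v) = 1 \<and> vnorm (D *\<^sub>v w) = 1}.
        ereal (deriv3 F \<theta> u v w))"

definition deriv3_sup_norm :: "nat \<Rightarrow> real mat \<Rightarrow> (real vec \<Rightarrow> real) \<Rightarrow> ereal" where
  "deriv3_sup_norm p D F = (SUP \<theta>\<in>carrier_vec p. deriv3_norm D F \<theta>)"

subsection \<open>The posterior\<close>

definition q_fun :: "(nat \<Rightarrow> real \<Rightarrow> real) \<Rightarrow> nat \<Rightarrow> real vec \<Rightarrow> real \<Rightarrow> real" where
  "q_fun \<phi> p \<theta> = (\<lambda>x. \<Sum>k<p. \<theta> $ k * \<phi> (Suc k) x)"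

definition design_mat ::
  "((real \<Rightarrow> real) \<Rightarrow> real \<Rightarrow> real) \<Rightarrow> (nat \<Rightarrow> real \<Rightarrow> real) \<Rightarrow> nat \<Rightarrow> nat \<Rightarrow> real mat" where
  "design_mat R \<phi> n p = mat n p (\<lambda>(j, k). R (\<phi> (Suc k)) (real (Suc j) / real n))"

definition Psi_mat :: "(nat \<Rightarrow> real \<Rightarrow> real) \<Rightarrow> nat \<Rightarrow> nat \<Rightarrow> real mat" where
  "Psi_mat \<psi> n p = mat p p
     (\<lambda>(k, l). \<Sum>j=1..n. \<psi> (Suc k) (real j / real n) * \<psi> (Suc l) (real j / real n))"

text \<open>In the next two definitions \<open>A\<close> is the design matrix, and the data are \<open>Y 1, \<dots>, Y n\<close>.\<close>

definition neg_loglik :: "(real \<Rightarrow> real) \<Rightarrow> real mat \<Rightarrow> (nat \<Rightarrow> real) \<Rightarrow> real vec \<Rightarrow> real" where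
  "neg_loglik h A Y \<theta> =
     (\<Sum>j<dim_row A. h (row A j \<bullet> \<theta>) - Y (Suc j) * (row A j \<bullet> \<theta>))"

definition neg_logpost ::
  "(real \<Rightarrow> real) \<Rightarrow> real \<Rightarrow> real mat \<Rightarrow> (nat \<Rightarrow> real) \<Rightarrow> real vec \<Rightarrow> real" where
  "neg_logpost h \<gamma> A Y \<theta> =
     neg_loglik h A Y \<theta> + (1 / 2) * (vnorm (diag_powr (dim_col A) \<gamma> *\<^sub>v \<theta>))\<^sup>2"

definition alpha :: "real mat \<Rightarrow> real mat \<Rightarrow> real" where
  "alpha DG D = op_norm (mat_inv DG * D)"

definition eff_dim :: "real mat \<Rightarrow> real mat \<Rightarrow> real" where
  "eff_dim DG D = trace (mat_inv DG ^\<^sub>m 2 * D ^\<^sub>m 2) / (alpha DG D)\<^sup>2"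

definition comparable :: "real \<Rightarrow> real \<Rightarrow> real \<Rightarrow> bool" where
  "comparable K x y \<longleftrightarrow> y / K \<le> x \<and> x \<le> K * y"

end

theory Submission
  imports Defs "Jordan_Normal_Form.Determinant"
begin

unbundle no inner_syntax

text \<open>Everything is reduced to diagonal matrices. Where the predictions are bounded by \<open>C\<^sub>0\<close>, the
  second derivative of \<open>h\<close> is bounded above and away from zero, so with hypothesis (ii) the squares
  of the matrices \<open>DG\<close> and \<open>D0\<close> are equivalent as quadratic forms to the diagonal matrices with
  entries \<open>n * k powr (- 2 * \<beta>) + k powr (2 * \<sigma>)\<close>, where \<open>\<sigma>\<close> is \<open>\<gamma>\<close> and \<open>\<gamma>0\<close> respectively.
  Traces and smallest eigenvalues become sums and minima over \<open>k \<le> p\<close>, split at the cutoff \<open>m\<close>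
  where both summands agree. The choice of \<open>\<gamma>0\<close> leaves the tail sum of \<open>k powr (- 1 - 1 / m)\<close> over
  \<open>k > m\<close>, which is at most \<open>(1 + m) * m powr (- 1 / m) \<le> 2 * m\<close>. The third derivative is a sum over
  the design points of third derivatives of \<open>h\<close> times three linear forms: one factor is bounded
  uniformly in the design point by the Cauchy--Schwarz inequality with the diagonal weights, the
  other two by the quadratic form itself.\<close>

subsection \<open>Symmetric matrices and effective dimension\<close>

text \<open>No eigenvectors are computed. \<open>alpha DG D\<close> enters only as the least
  \<open>c\<close> with \<open>vnorm (D *\<^sub>v u) \<le> c * vnorm (DG *\<^sub>v u)\<close>, and
  the trace only through norms of transformed unit vectors, so two-sided bounds on quadratic forms
  are enough. The obstacle is the error term of hypothesis (ii): in coordinate k it has order k^(lam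
  - 2 \<beta>) and has to be absorbed by the penalty k^(2 \<gamma>0), which asks for lam - 2 \<beta>
  \<le> 2 \<gamma>0. Constants independent of n also ask for 2 \<beta> + 2 \<gamma>0 - 1 to stay
  away from 0. As 2 \<gamma>0 = 2 \<gamma> - 1 - 1/m, both demands hold once 1/m is small, and 2
  \<beta> + 2 \<gamma> > max(2, lam + 1) says precisely that they are strict in the limit. Apart
  from n \<ge> 1, this is all that "n large" is used for. The 1/m in \<gamma>0 avoids a harmonic
  tail: the exponent -1 would give log(p/m), which is not bounded by a multiple of m uniformly in p.
  With the shift the tail converges, and the price 1/(s - 1) = m of an exponent s = 1 + 1/m close to
  1 is just affordable.\<close>

lemma scalar_prod_self_nonneg: "0 \<le> v \<bullet> (v :: real vec)"
  by (auto simp: scalar_prod_def intro!: sum_nonneg)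

lemma vnorm_nonneg: "0 \<le> vnorm v"
  by (simp add: vnorm_def scalar_prod_self_nonneg)

lemma vnorm_sq: "(vnorm v)\<^sup>2 = v \<bullet> v"
  by (simp add: vnorm_def scalar_prod_self_nonneg)

lemma vnorm_sq_sum:
  assumes "v \<in> carrier_vec p"
  shows "(vnorm v)\<^sup>2 = (\<Sum>i<p. (v $ i)\<^sup>2)"
  unfolding vnorm_sq using assms by (auto simp: scalar_prod_def power2_eq_square lessThan_atLeast0)

lemma vnorm_smult: "vnorm (c \<cdot>\<^sub>v v) = \<bar>c\<bar> * vnorm v"
proof -
  have "(vnorm (c \<cdot>\<^sub>v v))\<^sup>2 = (\<bar>c\<bar> * vnorm v)\<^sup>2"
    by (simp add: vnorm_sq power_mult_distrib power2_eq_square[of c])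
  then show ?thesis by (simp add: vnorm_nonneg power2_eq_iff_nonneg)
qed

lemma vnorm_pos:
  assumes "v \<in> carrier_vec p" "v \<noteq> 0\<^sub>v p"
  shows "0 < vnorm v"
proof -
  from assms obtain i where i: "i < p" "v $ i \<noteq> 0"
    by (metis carrier_vecD eq_vecI index_zero_vec(1) index_zero_vec(2))
  have "0 < (\<Sum>i<p. (v $ i)\<^sup>2)"
    using i by (intro sum_pos2[of _ i]) auto
  then show ?thesis
    using vnorm_sq_sum[OF assms(1)] vnorm_nonneg[of v] by (metis less_eq_real_def zero_power2 order_less_irrefl)
qed

lemma vnorm_unit_vec: "i < p \<Longrightarrow> vnorm (unit_vec p i) = 1"
  by (simp add: vnorm_def)

lemma vnorm_Cauchy_Schwarz:
  assumes "u \<in> carrier_vec p" "v \<in> carrier_vec p"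
  shows "\<bar>u \<bullet> v\<bar> \<le> vnorm u * vnorm v"
proof -
  have "(u \<bullet> v)\<^sup>2 \<le> (vnorm u * vnorm v)\<^sup>2"
    using Cauchy_Schwarz_ineq_sum[of "\<lambda>i. u $ i" "\<lambda>i. v $ i" "{..<p}"] assms
    by (simp add: power_mult_distrib vnorm_sq_sum scalar_prod_def lessThan_atLeast0)
  then show ?thesis
    by (metis abs_ge_zero mult_nonneg_nonneg power2_abs power2_le_imp_le vnorm_nonneg)
qed

lemma symmetric_scalar_prod:
  fixes A :: "real mat"
  assumes "A \<in> carrier_mat p p" "transpose_mat A = A" "u \<in> carrier_vec p" "v \<in> carrier_vec p"
  shows "(A *\<^sub>v u) \<bullet> v = u \<bullet> (A *\<^sub>v v)"
  using transpose_vec_mult_scalar[OF assms(1,4,3)] assms(2) by simp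

lemma pow_mat_2: "A \<in> carrier_mat p p \<Longrightarrow> A ^\<^sub>m 2 = A * A"
  by (simp add: numeral_2_eq_2)

lemma vnorm_symmetric_sq:
  fixes A :: "real mat"
  assumes "A \<in> carrier_mat p p" "transpose_mat A = A" "u \<in> carrier_vec p"
  shows "(vnorm (A *\<^sub>v u))\<^sup>2 = u \<bullet> ((A ^\<^sub>m 2) *\<^sub>v u)"
  using assms symmetric_scalar_prod[OF assms, of "A *\<^sub>v u"]
  by (simp add: vnorm_sq pow_mat_2[OF assms(1)])

text \<open>Positivity rules out a kernel vector, so the determinant is nonzero and the option
  behind \<open>mat_inv\<close> holds a genuine inverse. Symmetry follows by multiplying
  \<open>transpose_mat (mat_inv G) * G = 1\<^sub>m p\<close> with \<open>mat_inv G\<close> from the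
  right.\<close>

lemma sym_pos_def_inverse:
  assumes "sym_pos_def p G"
  shows "mat_inv G \<in> carrier_mat p p" "G * mat_inv G = 1\<^sub>m p" "mat_inv G * G = 1\<^sub>m p"
    "transpose_mat (mat_inv G) = mat_inv G"
proof -
  have G: "G \<in> carrier_mat p p" and sym: "transpose_mat G = G"
    and pos: "\<And>v. v \<in> carrier_vec p \<Longrightarrow> v \<noteq> 0\<^sub>v p \<Longrightarrow> v \<bullet> (G *\<^sub>v v) > 0"
    using assms by (auto simp: sym_pos_def_def)
  have "det G \<noteq> 0"
  proof
    assume "det G = 0"
    then obtain v where v: "v \<in> carrier_vec p" "v \<noteq> 0\<^sub>v p" "G *\<^sub>v v = 0\<^sub>v p"
      using det_0_iff_vec_prod_zero_field[OF G] by blast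
    show False using pos[OF v(1,2)] v by simp
  qed
  then have "G \<in> Units (ring_mat TYPE(real) p p)"
    by (rule det_non_zero_imp_unit[OF G])
  then obtain B where B: "mat_inverse G = Some B"
    using mat_inverse(1)[OF G, of p] by (cases "mat_inverse G") auto
  then have "mat_inv G = B" by (simp add: mat_inv_def)
  with mat_inverse(2)[OF G B] have I: "mat_inv G \<in> carrier_mat p p" "G * mat_inv G = 1\<^sub>m p" "mat_inv G * G = 1\<^sub>m p"
    by auto
  then show "mat_inv G \<in> carrier_mat p p" "G * mat_inv G = 1\<^sub>m p" "mat_inv G * G = 1\<^sub>m p" .
  let ?B = "mat_inv G"
  have "transpose_mat ?B * G = transpose_mat (G * ?B)"
    using transpose_mult[OF G I(1)] sym by simp
  then have "transpose_mat ?B * G = 1\<^sub>m p" using I by simp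
  then have "transpose_mat ?B * G * ?B = ?B" using I by simp
  moreover have "transpose_mat ?B * G * ?B = transpose_mat ?B"
    using I(1,2) G by (simp add: assoc_mult_mat[of _ p p _ p _ p])
  ultimately show "transpose_mat ?B = ?B" by simp
qed

lemma sym_pos_def_inverse_vec:
  assumes "sym_pos_def p G" "x \<in> carrier_vec p"
  shows "G *\<^sub>v (mat_inv G *\<^sub>v x) = x" "mat_inv G *\<^sub>v (G *\<^sub>v x) = x"
proof -
  note I = sym_pos_def_inverse[OF assms(1)]
  have G: "G \<in> carrier_mat p p" using assms by (auto simp: sym_pos_def_def)
  show "G *\<^sub>v (mat_inv G *\<^sub>v x) = x"
    using assoc_mult_mat_vec[OF G I(1) assms(2)] I(2) assms(2) by simp
  show "mat_inv G *\<^sub>v (G *\<^sub>v x) = x"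
    using assoc_mult_mat_vec[OF I(1) G assms(2)] I(3) assms(2) by simp
qed

lemma vnorm_normalize:
  assumes "v \<in> carrier_vec p" "v \<noteq> 0\<^sub>v p"
  shows "vnorm ((1 / vnorm v) \<cdot>\<^sub>v v) = 1"
  using vnorm_pos[OF assms] by (simp add: vnorm_smult)

section \<open>\<open>alpha\<close> as the best constant in a comparison of two norms\<close>

context
  fixes p :: nat and G D :: "real mat" and c :: real
  assumes G: "sym_pos_def p G"
    and D: "D \<in> carrier_mat p p" "transpose_mat D = D"
    and le: "\<And>u. u \<in> carrier_vec p \<Longrightarrow> vnorm (D *\<^sub>v u) \<le> c * vnorm (G *\<^sub>v u)"
begin

text \<open>The hypothesis bounds D G^-1 (put u = G^-1 x), whereas \<open>alpha\<close> involves
  G^-1 D. The two are adjoint to each other, so the same \<open>c\<close> serves. The bound also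
  shows that the real supremum in \<open>op_norm\<close> is over a bounded set.\<close>

lemma vnorm_inverse_mult_le:
  assumes v: "v \<in> carrier_vec p"
  shows "vnorm ((mat_inv G * D) *\<^sub>v v) \<le> c * vnorm v"
proof -
  note I = sym_pos_def_inverse[OF G]
  define y where "y = mat_inv G *\<^sub>v (D *\<^sub>v v)"
  have y: "y \<in> carrier_vec p" using I D v by (auto simp: y_def)
  have By: "mat_inv G *\<^sub>v y \<in> carrier_vec p" using I y by auto
  have "(vnorm y)\<^sup>2 = (mat_inv G *\<^sub>v (D *\<^sub>v v)) \<bullet> y"
    by (simp add: vnorm_sq y_def)
  also have "\<dots> = (D *\<^sub>v v) \<bullet> (mat_inv G *\<^sub>v y)"
    using symmetric_scalar_prod[OF I(1,4) _ y, of "D *\<^sub>v v"] D v by auto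
  also have "\<dots> = v \<bullet> (D *\<^sub>v (mat_inv G *\<^sub>v y))"
    using symmetric_scalar_prod[OF D v By] .
  also have "\<dots> \<le> vnorm v * vnorm (D *\<^sub>v (mat_inv G *\<^sub>v y))"
    using vnorm_Cauchy_Schwarz[of v p "D *\<^sub>v (mat_inv G *\<^sub>v y)"] v D By
    by (meson abs_le_D1 mult_mat_vec_carrier)
  also have "\<dots> \<le> vnorm v * (c * vnorm y)"
    using le[OF By] sym_pos_def_inverse_vec(1)[OF G y] vnorm_nonneg by (simp add: mult_left_mono)
  finally have "vnorm y * vnorm y \<le> (c * vnorm v) * vnorm y"
    by (simp add: power2_eq_square algebra_simps)
  \<comment> \<open>The sign of \<open>c\<close> is not given; the hypothesis at
    \<open>mat_inv G *\<^sub>v v\<close> shows that \<open>c * vnorm v\<close> is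
    nonnegative.\<close>
  moreover have "vnorm y = 0 \<Longrightarrow> vnorm y \<le> c * vnorm v"
    using le[OF By] le[of "mat_inv G *\<^sub>v v"] v I sym_pos_def_inverse_vec(1)[OF G v] vnorm_nonneg
    by (metis mult_mat_vec_carrier order_trans)
  ultimately have "vnorm y \<le> c * vnorm v"
    using vnorm_nonneg[of y] by (metis less_eq_real_def mult_le_cancel_right_pos)
  then show ?thesis
    using assoc_mult_mat_vec[OF I(1) D(1) v] by (simp add: y_def)
qed

lemma alpha_le:
  assumes "1 \<le> p"
  shows "alpha G D \<le> c"
  unfolding alpha_def op_norm_def
proof (rule cSUP_least)
  have "unit_vec p 0 \<in> {v \<in> carrier_vec (dim_col (mat_inv G * D)). vnorm v = 1}"
    using assms D by (auto simp: vnorm_unit_vec)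
  then show "{v \<in> carrier_vec (dim_col (mat_inv G * D)). vnorm v = 1} \<noteq> {}" by blast
next
  fix v assume "v \<in> {v \<in> carrier_vec (dim_col (mat_inv G * D)). vnorm v = 1}"
  then show "vnorm (mat_inv G * D *\<^sub>v v) \<le> c"
    using vnorm_inverse_mult_le[of v] D by auto
qed

text \<open>Together with \<open>alpha_le\<close> this makes \<open>alpha G D\<close> the least
  admissible \<open>c\<close>, and every later value or bound of \<open>alpha\<close> is read off
  from this extremal property. The test vector is D u normalised, whose pairing with D u returns the
  norm of D u.\<close>

lemma alpha_ge:
  assumes u: "u \<in> carrier_vec p"
  shows "vnorm (D *\<^sub>v u) \<le> alpha G D * vnorm (G *\<^sub>v u)"
proof (cases "D *\<^sub>v u = 0\<^sub>v p \<or> u = 0\<^sub>v p")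
  case True
  have bdd: "bdd_above ((\<lambda>v. vnorm (mat_inv G * D *\<^sub>v v)) ` {v \<in> carrier_vec (dim_col (mat_inv G * D)). vnorm v = 1})"
    using vnorm_inverse_mult_le D by (intro bdd_aboveI[of _ c]) force
  have "u = 0\<^sub>v p \<Longrightarrow> D *\<^sub>v u = 0\<^sub>v p"
    using D by (auto simp: scalar_prod_def)
  with True have Du: "vnorm (D *\<^sub>v u) = 0" by (auto simp: vnorm_def)
  show ?thesis
  proof (cases "u = 0\<^sub>v p")
    case True
    then have "vnorm (G *\<^sub>v u) = 0" using G by (auto simp: vnorm_def sym_pos_def_def scalar_prod_def)
    then show ?thesis using Du by simp
  next
    case False
    \<comment> \<open>Since D u = 0, only the sign of \<open>alpha G D\<close> matters; the
      normalised u is a witness for it.\<close>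
    have "0 \<le> vnorm (mat_inv G * D *\<^sub>v ((1 / vnorm u) \<cdot>\<^sub>v u))" by (rule vnorm_nonneg)
    also have "\<dots> \<le> alpha G D" unfolding alpha_def op_norm_def
      by (rule cSUP_upper[OF _ bdd]) (use u D False in \<open>auto simp: vnorm_normalize\<close>)
    finally show ?thesis using Du vnorm_nonneg[of "G *\<^sub>v u"] by simp
  qed
next
  case False
  note I = sym_pos_def_inverse[OF G]
  have Gc: "G \<in> carrier_mat p p" "transpose_mat G = G" using G by (auto simp: sym_pos_def_def)
  define z where "z = (1 / vnorm (D *\<^sub>v u)) \<cdot>\<^sub>v (D *\<^sub>v u)"
  have Du: "D *\<^sub>v u \<in> carrier_vec p" using D u by auto
  have Dpos: "0 < vnorm (D *\<^sub>v u)" using vnorm_pos[OF Du] False by auto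
  have z: "z \<in> carrier_vec p" "vnorm z = 1"
    using Du vnorm_normalize[OF Du] False by (auto simp: z_def)
  have bdd: "bdd_above ((\<lambda>v. vnorm (mat_inv G * D *\<^sub>v v)) ` {v \<in> carrier_vec (dim_col (mat_inv G * D)). vnorm v = 1})"
    using vnorm_inverse_mult_le D by (intro bdd_aboveI[of _ c]) force
  have al: "vnorm (mat_inv G * D *\<^sub>v z) \<le> alpha G D"
    unfolding alpha_def op_norm_def
    by (rule cSUP_upper[OF _ bdd]) (use z D in auto)
  define y where "y = mat_inv G *\<^sub>v (D *\<^sub>v z)"
  have y: "y \<in> carrier_vec p" "mat_inv G * D *\<^sub>v z = y"
    using I D z assoc_mult_mat_vec[OF I(1) D(1) z(1)] by (auto simp: y_def)
  have Gu: "G *\<^sub>v u \<in> carrier_vec p" using Gc u by auto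
  have Dz: "D *\<^sub>v z \<in> carrier_vec p" using D z by auto
  have "y \<bullet> (G *\<^sub>v u) = (G *\<^sub>v y) \<bullet> u"
    using symmetric_scalar_prod[OF Gc y(1) u] by simp
  also have "\<dots> = (D *\<^sub>v z) \<bullet> u"
    using sym_pos_def_inverse_vec(1)[OF G Dz] by (simp add: y_def)
  also have "\<dots> = z \<bullet> (D *\<^sub>v u)"
    using symmetric_scalar_prod[OF D z(1) u] .
  also have "\<dots> = vnorm (D *\<^sub>v u)"
    using Du Dpos by (simp add: z_def vnorm_sq[symmetric] power2_eq_square)
  finally have "vnorm (D *\<^sub>v u) \<le> vnorm y * vnorm (G *\<^sub>v u)"
    using vnorm_Cauchy_Schwarz[OF y(1) Gu] by simp
  also have "\<dots> \<le> alpha G D * vnorm (G *\<^sub>v u)"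
    using al y vnorm_nonneg by (simp add: mult_right_mono)
  finally show ?thesis .
qed

end

text \<open>By cyclicity the trace is that of G^-1 D^2 G^-1, whose diagonal entries are squared
  norms. In this form D enters only through the values of its quadratic form.\<close>

lemma trace_inverse_sq:
  assumes G: "sym_pos_def p G"
    and D: "D \<in> carrier_mat p p" "transpose_mat D = D"
  shows "trace (mat_inv G ^\<^sub>m 2 * D ^\<^sub>m 2) = (\<Sum>i<p. (vnorm (D *\<^sub>v (mat_inv G *\<^sub>v unit_vec p i)))\<^sup>2)"
proof -
  note I = sym_pos_def_inverse[OF G]
  let ?B = "mat_inv G"
  have D2: "D ^\<^sub>m 2 \<in> carrier_mat p p" "transpose_mat (D ^\<^sub>m 2) = D ^\<^sub>m 2"
    using D transpose_mult[OF D(1) D(1)] by (auto simp: pow_mat_2)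
  have "trace (?B ^\<^sub>m 2 * D ^\<^sub>m 2) = (\<Sum>i<p. (\<Sum>k<p. ?B $$ (i,k) * (?B * D ^\<^sub>m 2) $$ (k,i)))"
  proof -
    have "?B ^\<^sub>m 2 * D ^\<^sub>m 2 = ?B * (?B * D ^\<^sub>m 2)"
      using I D2 by (simp add: pow_mat_2[OF I(1)] assoc_mult_mat[of _ p p _ p _ p])
    moreover have "trace (?B * X) = (\<Sum>i<p. \<Sum>k<p. ?B $$ (i,k) * X $$ (k,i))" if "X \<in> carrier_mat p p" for X
      using I(1) that unfolding trace_def
      by (intro sum.cong) (auto simp: scalar_prod_def lessThan_atLeast0)
    ultimately show ?thesis using I(1) D2 by simp
  qed
  also have "\<dots> = (\<Sum>k<p. (\<Sum>i<p. (?B * D ^\<^sub>m 2) $$ (k,i) * ?B $$ (i,k)))"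
    by (subst sum.swap) (simp add: mult.commute)
  also have "\<dots> = (\<Sum>k<p. (?B * D ^\<^sub>m 2 * ?B) $$ (k,k))"
    using I D D2 by (intro sum.cong) (auto simp: scalar_prod_def lessThan_atLeast0)
  also have "\<dots> = (\<Sum>k<p. (vnorm (D *\<^sub>v (?B *\<^sub>v unit_vec p k)))\<^sup>2)"
  proof (intro sum.cong refl)
    fix k assume k: "k \<in> {..<p}"
    let ?e = "unit_vec p k :: real vec"
    have Be: "?B *\<^sub>v ?e \<in> carrier_vec p" using I by auto
    have "(vnorm (D *\<^sub>v (?B *\<^sub>v ?e)))\<^sup>2 = (?B *\<^sub>v ?e) \<bullet> (D ^\<^sub>m 2 *\<^sub>v (?B *\<^sub>v ?e))"
      using vnorm_symmetric_sq[OF D Be] .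
    also have "\<dots> = ?e \<bullet> (?B *\<^sub>v (D ^\<^sub>m 2 *\<^sub>v (?B *\<^sub>v ?e)))"
      using symmetric_scalar_prod[OF I(1,4), of ?e] D2 Be by auto
    also have "?B *\<^sub>v (D ^\<^sub>m 2 *\<^sub>v (?B *\<^sub>v ?e)) = (?B * D ^\<^sub>m 2 * ?B) *\<^sub>v ?e"
      using I D2 Be by (simp add: assoc_mult_mat_vec[of _ p p _ p])
    also have "?e \<bullet> \<dots> = (?B * D ^\<^sub>m 2 * ?B) $$ (k,k)"
    proof -
      have "?B * D ^\<^sub>m 2 * ?B \<in> carrier_mat p p" using I D2 by auto
      moreover have "?e \<bullet> (X *\<^sub>v ?e) = X $$ (k,k)" if "X \<in> carrier_mat p p" for X
        using that k by simp
      ultimately show ?thesis by blast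
    qed
    finally show "(?B * D ^\<^sub>m 2 * ?B) $$ (k,k) = (vnorm (D *\<^sub>v (?B *\<^sub>v ?e)))\<^sup>2" ..
  qed
  finally show ?thesis .
qed

text \<open>The left side is the k-th diagonal entry of G^-2, that is z_k for z = G^-2 e_k. It also
  equals the squared norm of G z, hence is at least c d_k z_k^2; cancelling z_k gives the
  claim.\<close>

lemma vnorm_inverse_unit_vec_le:
  assumes G: "sym_pos_def p G" and k: "k < p"
    and d: "\<And>i. i < p \<Longrightarrow> 0 < d i" and c: "0 < c"
    and le: "\<And>u. u \<in> carrier_vec p \<Longrightarrow> c * (\<Sum>i<p. d i * (u $ i)\<^sup>2) \<le> (vnorm (G *\<^sub>v u))\<^sup>2"
  shows "(vnorm (mat_inv G *\<^sub>v unit_vec p k))\<^sup>2 \<le> 1 / (c * d k)"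
proof -
  note I = sym_pos_def_inverse[OF G]
  let ?B = "mat_inv G" and ?e = "unit_vec p k :: real vec"
  have Be: "?B *\<^sub>v ?e \<in> carrier_vec p" using I by auto
  define z where "z = ?B *\<^sub>v (?B *\<^sub>v ?e)"
  have z: "z \<in> carrier_vec p" using I Be by (auto simp: z_def)
  have Gz: "G *\<^sub>v z = ?B *\<^sub>v ?e"
    using sym_pos_def_inverse_vec(1)[OF G Be] by (simp add: z_def)
  have zk: "(vnorm (?B *\<^sub>v ?e))\<^sup>2 = z $ k"
    using symmetric_scalar_prod[OF I(1,4) _ Be, of ?e] k z
    by (simp add: vnorm_sq z_def[symmetric])
  have "c * (d k * (z $ k)\<^sup>2) \<le> c * (\<Sum>i<p. d i * (z $ i)\<^sup>2)"
    using d c k by (intro mult_left_mono member_le_sum) (auto intro!: mult_nonneg_nonneg dest: less_imp_le)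
  also have "\<dots> \<le> z $ k"
    using le[OF z] Gz zk by simp
  finally have "(c * d k * z $ k) * z $ k \<le> 1 * z $ k"
    by (simp add: power2_eq_square algebra_simps)
  moreover have "0 \<le> z $ k" using zk by (metis zero_le_power2)
  ultimately have "c * d k * z $ k \<le> 1"
    by (metis less_eq_real_def mult_le_cancel_right_pos mult_zero_right zero_le_one)
  then show ?thesis
    using d[OF k] c zk by (simp add: field_simps)
qed

text \<open>Cauchy-Schwarz applied to 1 = <G^-1 e_k, G e_k>; hence the form of G has to be bounded
  at one vector only.\<close>

lemma vnorm_inverse_unit_vec_ge:
  assumes G: "sym_pos_def p G" and k: "k < p" and C: "0 < C"
    and le: "(vnorm (G *\<^sub>v unit_vec p k))\<^sup>2 \<le> C"
  shows "1 / C \<le> (vnorm (mat_inv G *\<^sub>v unit_vec p k))\<^sup>2"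
proof -
  note I = sym_pos_def_inverse[OF G]
  have Gc: "G \<in> carrier_mat p p" "transpose_mat G = G" using G by (auto simp: sym_pos_def_def)
  let ?B = "mat_inv G" and ?e = "unit_vec p k :: real vec"
  have Be: "?B *\<^sub>v ?e \<in> carrier_vec p" using I by auto
  have Ge: "G *\<^sub>v ?e \<in> carrier_vec p" using Gc by auto
  have "1 = ?e \<bullet> ?e" using k by simp
  also have "\<dots> = (G *\<^sub>v (?B *\<^sub>v ?e)) \<bullet> ?e"
    using sym_pos_def_inverse_vec(1)[OF G] by simp
  also have "\<dots> = (?B *\<^sub>v ?e) \<bullet> (G *\<^sub>v ?e)"
    using symmetric_scalar_prod[OF Gc Be] by simp
  also have "\<dots> \<le> vnorm (?B *\<^sub>v ?e) * vnorm (G *\<^sub>v ?e)"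
    using vnorm_Cauchy_Schwarz[OF Be Ge] by simp
  finally have "1 \<le> (vnorm (?B *\<^sub>v ?e) * vnorm (G *\<^sub>v ?e))\<^sup>2"
    by (simp add: one_le_power)
  also have "\<dots> \<le> (vnorm (?B *\<^sub>v ?e))\<^sup>2 * C"
    using le by (simp add: power_mult_distrib mult_left_mono)
  finally show ?thesis using C by (simp add: field_simps)
qed

text \<open>Symmetry of G^-1 exchanges rows and columns, so that the trace against a diagonal matrix
  becomes a weighted sum of diagonal entries of G^-2, to which the two preceding estimates
  apply.\<close>

lemma sum_inverse_unit_vec_swap:
  assumes G: "sym_pos_def p G"
  shows "(\<Sum>i<p. \<Sum>k<p. d k * ((mat_inv G *\<^sub>v unit_vec p i) $ k)\<^sup>2) =
    (\<Sum>k<p. d k * (vnorm (mat_inv G *\<^sub>v unit_vec p k))\<^sup>2)"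
proof -
  note I = sym_pos_def_inverse[OF G]
  let ?B = "mat_inv G"
  have entry: "(?B *\<^sub>v unit_vec p i) $ k = (?B *\<^sub>v unit_vec p k) $ i" if "i < p" "k < p" for i k
  proof -
    have "?B $$ (k, i) = transpose_mat ?B $$ (k, i)" using I(4) by simp
    also have "\<dots> = ?B $$ (i, k)" using I(1) that by simp
    finally show ?thesis using I(1) that by simp
  qed
  have "(\<Sum>i<p. \<Sum>k<p. d k * ((?B *\<^sub>v unit_vec p i) $ k)\<^sup>2) =
      (\<Sum>k<p. \<Sum>i<p. d k * ((?B *\<^sub>v unit_vec p k) $ i)\<^sup>2)"
    by (subst sum.swap) (intro sum.cong refl, auto simp: entry simp del: index_mult_mat_vec)
  also have "\<dots> = (\<Sum>k<p. d k * (vnorm (?B *\<^sub>v unit_vec p k))\<^sup>2)"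
    using I(1) by (intro sum.cong refl) (subst vnorm_sq_sum[of _ p], auto simp: sum_distrib_left)
  finally show ?thesis .
qed

text \<open>D^2 is replaced by its diagonal model under the trace, then each diagonal entry of G^-2
  by 1/g_k. Inversion swaps the roles of \<open>c\<close> and \<open>C\<close>, whence
  \<open>c1 / C\<close> below and \<open>C1 / c\<close> above.\<close>

lemma trace_inverse_sq_bounds:
  assumes G: "sym_pos_def p G"
    and D: "D \<in> carrier_mat p p" "transpose_mat D = D"
    and d: "\<And>i. i < p \<Longrightarrow> 0 \<le> d i"
    and g: "\<And>i. i < p \<Longrightarrow> 0 < g i" and c: "0 < c" "0 < C" "0 \<le> c1" "0 \<le> C1"
    and leD: "\<And>u. u \<in> carrier_vec p \<Longrightarrow> c1 * (\<Sum>i<p. d i * (u $ i)\<^sup>2) \<le> (vnorm (D *\<^sub>v u))\<^sup>2"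
      "\<And>u. u \<in> carrier_vec p \<Longrightarrow> (vnorm (D *\<^sub>v u))\<^sup>2 \<le> C1 * (\<Sum>i<p. d i * (u $ i)\<^sup>2)"
    and leG: "\<And>u. u \<in> carrier_vec p \<Longrightarrow> c * (\<Sum>i<p. g i * (u $ i)\<^sup>2) \<le> (vnorm (G *\<^sub>v u))\<^sup>2"
      "\<And>u. u \<in> carrier_vec p \<Longrightarrow> (vnorm (G *\<^sub>v u))\<^sup>2 \<le> C * (\<Sum>i<p. g i * (u $ i)\<^sup>2)"
  shows "c1 / C * (\<Sum>i<p. d i / g i) \<le> trace (mat_inv G ^\<^sub>m 2 * D ^\<^sub>m 2)"
    and "trace (mat_inv G ^\<^sub>m 2 * D ^\<^sub>m 2) \<le> C1 / c * (\<Sum>i<p. d i / g i)"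
proof -
  note I = sym_pos_def_inverse[OF G]
  let ?B = "mat_inv G"
  have Be: "?B *\<^sub>v unit_vec p i \<in> carrier_vec p" for i using I by auto
  note tr = trace_inverse_sq[OF G D]
  have unit: "(\<Sum>i<p. g i * (unit_vec p k $ i :: real)\<^sup>2) = g k" if "k < p" for k
  proof -
    have "(\<Sum>i<p. g i * (unit_vec p k $ i :: real)\<^sup>2) = (\<Sum>i<p. if i = k then g k else 0)"
      using that by (intro sum.cong) auto
    then show ?thesis using that by simp
  qed
  have "(\<Sum>k<p. c1 * (d k * (1 / (C * g k)))) \<le> (\<Sum>k<p. c1 * (d k * (vnorm (?B *\<^sub>v unit_vec p k))\<^sup>2))"
    using d g c leG(2)[OF unit_vec_carrier] unit
    by (intro sum_mono mult_left_mono vnorm_inverse_unit_vec_ge[OF G])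
      (auto simp del: index_unit_vec, metis)
  also have "\<dots> = (\<Sum>i<p. c1 * (\<Sum>k<p. d k * ((?B *\<^sub>v unit_vec p i) $ k)\<^sup>2))"
    by (simp only: sum_inverse_unit_vec_swap[OF G, symmetric] sum_distrib_left[symmetric])
  also have "\<dots> \<le> trace (?B ^\<^sub>m 2 * D ^\<^sub>m 2)"
    unfolding tr by (intro sum_mono leD Be)
  finally show "c1 / C * (\<Sum>i<p. d i / g i) \<le> trace (?B ^\<^sub>m 2 * D ^\<^sub>m 2)"
    by (simp add: sum_distrib_left)
  have "trace (?B ^\<^sub>m 2 * D ^\<^sub>m 2) \<le> (\<Sum>i<p. C1 * (\<Sum>k<p. d k * ((?B *\<^sub>v unit_vec p i) $ k)\<^sup>2))"
    unfolding tr by (intro sum_mono leD Be)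
  also have "\<dots> = (\<Sum>k<p. C1 * (d k * (vnorm (?B *\<^sub>v unit_vec p k))\<^sup>2))"
    by (simp only: sum_inverse_unit_vec_swap[OF G, symmetric] sum_distrib_left[symmetric])
  also have "\<dots> \<le> (\<Sum>k<p. C1 * (d k * (1 / (c * g k))))"
    using d g c leG(1)
    by (intro sum_mono mult_left_mono vnorm_inverse_unit_vec_le[OF G, where d = g]) auto
  finally show "trace (?B ^\<^sub>m 2 * D ^\<^sub>m 2) \<le> C1 / c * (\<Sum>i<p. d i / g i)"
    by (simp add: sum_distrib_left)
qed

subsection \<open>Derivatives of the posterior\<close>

text \<open>Sums of ridge functions are closed under partial derivatives: only the profile
  \<open>g j\<close> changes, into \<open>a j $ c\<close> times its derivative. Iteration gives the
  Hessian and the third derivative. The ridge form of \<open>F\<close> is asked for on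
  \<open>carrier_vec p\<close> only, which contains the line through \<theta>.\<close>

lemma partial_deriv_ridge_sum:
  fixes a :: "'i \<Rightarrow> real vec" and g g' :: "'i \<Rightarrow> real \<Rightarrow> real"
  assumes a: "\<And>j. j \<in> J \<Longrightarrow> a j \<in> carrier_vec p"
    and F: "\<And>\<theta>. \<theta> \<in> carrier_vec p \<Longrightarrow> F \<theta> = (\<Sum>j\<in>J. g j (a j \<bullet> \<theta>))"
    and g: "\<And>j t. j \<in> J \<Longrightarrow> (g j has_real_derivative g' j t) (at t)"
    and \<theta>: "\<theta> \<in> carrier_vec p" and c: "c < p"
  shows "partial_deriv c F \<theta> = (\<Sum>j\<in>J. a j $ c * g' j (a j \<bullet> \<theta>))"
proof -
  have "F (\<theta> + t \<cdot>\<^sub>v unit_vec (dim_vec \<theta>) c) = (\<Sum>j\<in>J. g j (a j \<bullet> \<theta> + t * a j $ c))" for t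
  proof -
    have "F (\<theta> + t \<cdot>\<^sub>v unit_vec (dim_vec \<theta>) c) = (\<Sum>j\<in>J. g j (a j \<bullet> (\<theta> + t \<cdot>\<^sub>v unit_vec p c)))"
      using \<theta> by (subst F) auto
    also have "\<dots> = (\<Sum>j\<in>J. g j (a j \<bullet> \<theta> + t * a j $ c))"
      using a \<theta> c by (intro sum.cong refl) (simp add: scalar_prod_add_distrib[of _ p])
    finally show ?thesis .
  qed
  moreover have "((\<lambda>t. \<Sum>j\<in>J. g j (a j \<bullet> \<theta> + t * a j $ c)) has_real_derivative
      (\<Sum>j\<in>J. a j $ c * g' j (a j \<bullet> \<theta>))) (at 0)"
  proof (rule DERIV_sum)
    fix j assume j: "j \<in> J"
    have "((\<lambda>t. a j \<bullet> \<theta> + t * a j $ c) has_real_derivative a j $ c) (at 0)"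
      by (auto intro!: derivative_eq_intros)
    with DERIV_chain2[of "g j" _ "\<lambda>t. a j \<bullet> \<theta> + t * a j $ c" 0] g[OF j, of "a j \<bullet> \<theta> + 0 * a j $ c"]
    have "((\<lambda>t. g j (a j \<bullet> \<theta> + t * a j $ c)) has_real_derivative g' j (a j \<bullet> \<theta> + 0 * a j $ c) * a j $ c) (at 0)"
      by blast
    then show "((\<lambda>t. g j (a j \<bullet> \<theta> + t * a j $ c)) has_real_derivative a j $ c * g' j (a j \<bullet> \<theta>)) (at 0)"
      by (simp add: mult.commute)
  qed
  ultimately show ?thesis
    unfolding partial_deriv_def by (simp add: DERIV_imp_deriv)
qed

context
  fixes J :: "'i set" and a :: "'i \<Rightarrow> real vec" and p :: nat and F :: "real vec \<Rightarrow> real"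
    and g g1 g2 g3 :: "'i \<Rightarrow> real \<Rightarrow> real"
  assumes a: "\<And>j. j \<in> J \<Longrightarrow> a j \<in> carrier_vec p"
    and F: "\<And>\<theta>. \<theta> \<in> carrier_vec p \<Longrightarrow> F \<theta> = (\<Sum>j\<in>J. g j (a j \<bullet> \<theta>))"
    and g1: "\<And>j t. j \<in> J \<Longrightarrow> (g j has_real_derivative g1 j t) (at t)"
    and g2: "\<And>j t. j \<in> J \<Longrightarrow> (g1 j has_real_derivative g2 j t) (at t)"
begin

lemma partial_deriv2_ridge_sum:
  assumes "\<theta> \<in> carrier_vec p" "b < p" "c < p"
  shows "partial_deriv b (partial_deriv c F) \<theta> = (\<Sum>j\<in>J. a j $ b * (a j $ c * g2 j (a j \<bullet> \<theta>)))"
proof (rule partial_deriv_ridge_sum[OF a _ _ assms(1,2), where g = "\<lambda>j s. a j $ c * g1 j s"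
      and g' = "\<lambda>j s. a j $ c * g2 j s"])
  show "partial_deriv c F \<theta> = (\<Sum>j\<in>J. a j $ c * g1 j (a j \<bullet> \<theta>))" if "\<theta> \<in> carrier_vec p" for \<theta>
    by (rule partial_deriv_ridge_sum[OF a F g1 that assms(3)])
  show "((\<lambda>s. a j $ c * g1 j s) has_real_derivative a j $ c * g2 j t) (at t)" if "j \<in> J" for j t
    by (rule DERIV_cmult[OF g2[OF that]])
qed

lemma hessian_ridge_sum:
  assumes "\<theta> \<in> carrier_vec p"
  shows "hessian F \<theta> = mat p p (\<lambda>(b, c). \<Sum>j\<in>J. a j $ b * a j $ c * g2 j (a j \<bullet> \<theta>))"
  using assms partial_deriv2_ridge_sum[OF assms]
  by (intro eq_matI) (auto simp: hessian_def mult.assoc)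

text \<open>Once the sum over \<open>J\<close> is pulled outside, the triple sum over coordinates
  factors into three scalar products.\<close>

lemma deriv3_ridge_sum:
  assumes g3: "\<And>j t. j \<in> J \<Longrightarrow> (g2 j has_real_derivative g3 j t) (at t)"
    and \<theta>: "\<theta> \<in> carrier_vec p"
    and uvw: "u \<in> carrier_vec p" "v \<in> carrier_vec p" "w \<in> carrier_vec p"
  shows "deriv3 F \<theta> u v w = (\<Sum>j\<in>J. g3 j (a j \<bullet> \<theta>) * ((a j \<bullet> u) * (a j \<bullet> v) * (a j \<bullet> w)))"
proof -
  have D3: "partial_deriv x (partial_deriv y (partial_deriv z F)) \<theta> =
      (\<Sum>j\<in>J. a j $ x * (a j $ y * (a j $ z * g3 j (a j \<bullet> \<theta>))))" if "x < p" "y < p" "z < p" for x y z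
  proof (rule partial_deriv_ridge_sum[OF a _ _ \<theta> that(1), where g = "\<lambda>j s. a j $ y * (a j $ z * g2 j s)"
        and g' = "\<lambda>j s. a j $ y * (a j $ z * g3 j s)"])
    show "partial_deriv y (partial_deriv z F) \<theta> = (\<Sum>j\<in>J. a j $ y * (a j $ z * g2 j (a j \<bullet> \<theta>)))"
      if "\<theta> \<in> carrier_vec p" for \<theta>
      using that \<open>y < p\<close> \<open>z < p\<close> by (rule partial_deriv2_ridge_sum)
    show "((\<lambda>s. a j $ y * (a j $ z * g2 j s)) has_real_derivative a j $ y * (a j $ z * g3 j t)) (at t)" if "j \<in> J" for j t
      by (rule DERIV_cmult[OF DERIV_cmult[OF g3[OF that]]])
  qed
  have "deriv3 F \<theta> u v w = (\<Sum>x<p. \<Sum>y<p. \<Sum>z<p. \<Sum>j\<in>J.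
      g3 j (a j \<bullet> \<theta>) * ((a j $ x * u $ x) * (a j $ y * v $ y) * (a j $ z * w $ z)))"
  proof -
    have "deriv3 F \<theta> u v w = (\<Sum>x<p. \<Sum>y<p. \<Sum>z<p.
        (\<Sum>j\<in>J. a j $ x * (a j $ y * (a j $ z * g3 j (a j \<bullet> \<theta>)))) * (u $ x * v $ y * w $ z))"
      using \<theta> by (simp add: deriv3_def D3)
    then show ?thesis unfolding sum_distrib_right by (simp add: mult_ac)
  qed
  also have "\<dots> = (\<Sum>j\<in>J. \<Sum>x<p. \<Sum>y<p. \<Sum>z<p.
      g3 j (a j \<bullet> \<theta>) * ((a j $ x * u $ x) * (a j $ y * v $ y) * (a j $ z * w $ z)))"
    by (simp only: sum.swap[where B = J and A = "{..<p}"])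
  also have "\<dots> = (\<Sum>j\<in>J. g3 j (a j \<bullet> \<theta>) * ((a j \<bullet> u) * (a j \<bullet> v) * (a j \<bullet> w)))"
  proof (intro sum.cong refl)
    fix j assume "j \<in> J"
    have "(\<Sum>x<p. \<Sum>y<p. \<Sum>z<p. g3 j (a j \<bullet> \<theta>) * ((a j $ x * u $ x) * (a j $ y * v $ y) * (a j $ z * w $ z)))
       = g3 j (a j \<bullet> \<theta>) * ((\<Sum>x<p. a j $ x * u $ x) * (\<Sum>y<p. a j $ y * v $ y) * (\<Sum>z<p. a j $ z * w $ z))"
      by (simp only: sum_distrib_left[symmetric] sum_distrib_right[symmetric])
    then show "(\<Sum>x<p. \<Sum>y<p. \<Sum>z<p. g3 j (a j \<bullet> \<theta>) * ((a j $ x * u $ x) * (a j $ y * v $ y) * (a j $ z * w $ z)))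
       = g3 j (a j \<bullet> \<theta>) * ((a j \<bullet> u) * (a j \<bullet> v) * (a j \<bullet> w))"
      using uvw by (simp add: scalar_prod_def lessThan_atLeast0)
  qed
  finally show ?thesis .
qed

end

section \<open>Power-weighted quadratic penalties and the derivatives of the posterior\<close>

lemma diag_powr_mult_vec:
  assumes "u \<in> carrier_vec p" "k < p"
  shows "(diag_powr p s *\<^sub>v u) $ k = real (Suc k) powr s * u $ k"
proof -
  have "(diag_powr p s *\<^sub>v u) $ k = (\<Sum>i<p. (if k = i then real (Suc i) powr s else 0) * u $ i)"
    using assms by (auto simp: diag_powr_def mat_diag_def scalar_prod_def lessThan_atLeast0 simp del: of_nat_Suc)
  also have "\<dots> = (\<Sum>i<p. if i = k then real (Suc k) powr s * u $ k else 0)"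
    by (intro sum.cong) auto
  finally show ?thesis using assms by simp
qed

lemma diag_powr_carrier: "diag_powr p s \<in> carrier_mat p p"
  by (simp add: diag_powr_def)

lemma diag_powr_quadratic_form:
  assumes "u \<in> carrier_vec p"
  shows "u \<bullet> (diag_powr p s *\<^sub>v u) = (\<Sum>k<p. real (Suc k) powr s * (u $ k)\<^sup>2)"
  using assms diag_powr_carrier[of p s] 
  by (auto simp: scalar_prod_def lessThan_atLeast0 diag_powr_mult_vec power2_eq_square
      simp del: index_mult_mat_vec intro!: sum.cong)

lemma vnorm_diag_powr_sq:
  assumes "u \<in> carrier_vec p"
  shows "(vnorm (diag_powr p s *\<^sub>v u))\<^sup>2 = (\<Sum>k<p. real (Suc k) powr (2 * s) * (u $ k)\<^sup>2)"
proof -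
  have "(x powr s)\<^sup>2 = x powr (2 * s)" for x :: real
    by (simp add: power2_eq_square powr_add[symmetric])
  then show ?thesis
    using assms diag_powr_carrier[of p s] 
    by (subst vnorm_sq_sum[of _ p])
      (auto simp: diag_powr_mult_vec power_mult_distrib simp del: index_mult_mat_vec intro!: sum.cong)
qed

lemma deriv_funpow_Suc:
  fixes h :: "real \<Rightarrow> real"
  assumes "\<forall>k s. (deriv ^^ k) h differentiable (at s)"
  shows "((deriv ^^ k) h has_real_derivative (deriv ^^ Suc k) h t) (at t)"
  using assms DERIV_deriv_iff_real_differentiable[of "(deriv ^^ k) h" t] by simp

context
  fixes h :: "real \<Rightarrow> real" and A :: "real mat" and n p :: nat and Y :: "nat \<Rightarrow> real"
  assumes smooth: "\<forall>k s. (deriv ^^ k) h differentiable (at s)"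
    and A: "A \<in> carrier_mat n p"
begin

lemma hessian_neg_loglik:
  assumes \<theta>: "\<theta> \<in> carrier_vec p"
  shows "hessian (neg_loglik h A Y) \<theta> =
    mat p p (\<lambda>(b, c). \<Sum>j<n. row A j $ b * row A j $ c * (deriv ^^ 2) h (row A j \<bullet> \<theta>))"
proof (rule hessian_ridge_sum[OF _ _ _ _ \<theta>])
  show "\<And>j. j \<in> {..<n} \<Longrightarrow> row A j \<in> carrier_vec p" using A by auto
  show "\<And>\<theta>. neg_loglik h A Y \<theta> = (\<Sum>j<n. (\<lambda>s. h s - Y (Suc j) * s) (row A j \<bullet> \<theta>))"
    using A by (simp add: neg_loglik_def)
  show "((\<lambda>s. h s - Y (Suc j) * s) has_real_derivative (deriv ^^ 1) h t - Y (Suc j)) (at t)" for j t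
    using deriv_funpow_Suc[OF smooth, of 0 t] by (auto intro!: derivative_eq_intros)
  show "((\<lambda>t. (deriv ^^ 1) h t - Y (Suc j)) has_real_derivative (deriv ^^ 2) h t) (at t)" for j t
    using deriv_funpow_Suc[OF smooth, of 1 t]
    by (auto intro!: derivative_eq_intros simp: numeral_2_eq_2)
qed

lemma hessian_neg_loglik_quadratic_form:
  assumes \<theta>: "\<theta> \<in> carrier_vec p" and u: "u \<in> carrier_vec p"
  shows "u \<bullet> (hessian (neg_loglik h A Y) \<theta> *\<^sub>v u) = (\<Sum>j<n. (deriv ^^ 2) h (row A j \<bullet> \<theta>) * (row A j \<bullet> u)\<^sup>2)"
proof -
  let ?d = "\<lambda>j. (deriv ^^ 2) h (row A j \<bullet> \<theta>)"
  have "u \<bullet> (hessian (neg_loglik h A Y) \<theta> *\<^sub>v u) =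
      (\<Sum>b<p. \<Sum>c<p. \<Sum>j<n. ?d j * ((row A j $ b * u $ b) * (row A j $ c * u $ c)))"
    using u by (auto simp: hessian_neg_loglik[OF \<theta>] scalar_prod_def lessThan_atLeast0
        sum_distrib_right sum_distrib_left mult_ac intro!: sum.cong)
  also have "\<dots> = (\<Sum>j<n. \<Sum>b<p. \<Sum>c<p. ?d j * ((row A j $ b * u $ b) * (row A j $ c * u $ c)))"
    by (simp only: sum.swap[where B = "{..<n}" and A = "{..<p}"])
  also have "\<dots> = (\<Sum>j<n. ?d j * (row A j \<bullet> u)\<^sup>2)"
  proof (intro sum.cong refl)
    fix j
    have "(\<Sum>b<p. \<Sum>c<p. ?d j * ((row A j $ b * u $ b) * (row A j $ c * u $ c))) =
        ?d j * ((\<Sum>b<p. row A j $ b * u $ b) * (\<Sum>c<p. row A j $ c * u $ c))"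
      by (simp only: sum_distrib_left[symmetric] sum_distrib_right[symmetric])
    then show "(\<Sum>b<p. \<Sum>c<p. ?d j * ((row A j $ b * u $ b) * (row A j $ c * u $ c))) = ?d j * (row A j \<bullet> u)\<^sup>2"
      using u by (simp add: scalar_prod_def lessThan_atLeast0 power2_eq_square)
  qed
  finally show ?thesis .
qed

context
  fixes \<gamma> :: real
begin

text \<open>The quadratic penalty is treated as \<open>p\<close> further ridge functions, along the unit vectors.\<close>

abbreviation (input) ridge_dir :: "nat + nat \<Rightarrow> real vec" where
  "ridge_dir \<equiv> case_sum (row A) (unit_vec p)"

lemma neg_logpost_ridge_sum:
  assumes "\<theta> \<in> carrier_vec p"
  shows "neg_logpost h \<gamma> A Y \<theta> = (\<Sum>j\<in>{..<n} <+> {..<p}.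
    case_sum (\<lambda>j s. h s - Y (Suc j) * s) (\<lambda>k s. real (Suc k) powr (2 * \<gamma>) / 2 * s\<^sup>2) j (ridge_dir j \<bullet> \<theta>))"
  using assms A
  by (simp add: neg_logpost_def neg_loglik_def sum.Plus vnorm_diag_powr_sq sum_divide_distrib)

lemma neg_logpost_derivs:
  shows "(case_sum (\<lambda>j s. h s - Y (Suc j) * s) (\<lambda>k s. real (Suc k) powr (2 * \<gamma>) / 2 * s\<^sup>2) j
      has_real_derivative case_sum (\<lambda>j s. (deriv ^^ 1) h s - Y (Suc j)) (\<lambda>k s. real (Suc k) powr (2 * \<gamma>) * s) j t) (at t)"
    and "(case_sum (\<lambda>j s. (deriv ^^ 1) h s - Y (Suc j)) (\<lambda>k s. real (Suc k) powr (2 * \<gamma>) * s) j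
      has_real_derivative case_sum (\<lambda>j. (deriv ^^ 2) h) (\<lambda>k s. real (Suc k) powr (2 * \<gamma>)) j t) (at t)"
    and "(case_sum (\<lambda>j. (deriv ^^ 2) h) (\<lambda>k s. real (Suc k) powr (2 * \<gamma>)) j
      has_real_derivative case_sum (\<lambda>j. (deriv ^^ 3) h) (\<lambda>k s. 0) j t) (at t)"
  using deriv_funpow_Suc[OF smooth, of 0 t] deriv_funpow_Suc[OF smooth, of 1 t] deriv_funpow_Suc[OF smooth, of 2 t]
  by (cases j; auto intro!: derivative_eq_intros simp: eval_nat_numeral)+

lemma hessian_neg_logpost:
  assumes \<theta>: "\<theta> \<in> carrier_vec p"
  shows "hessian (neg_logpost h \<gamma> A Y) \<theta> = hessian (neg_loglik h A Y) \<theta> + diag_powr p (2 * \<gamma>)"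
proof -
  have "hessian (neg_logpost h \<gamma> A Y) \<theta> = mat p p (\<lambda>(b, c). \<Sum>j\<in>{..<n} <+> {..<p}.
      ridge_dir j $ b * ridge_dir j $ c *
      case_sum (\<lambda>j. (deriv ^^ 2) h) (\<lambda>k s. real (Suc k) powr (2 * \<gamma>)) j (ridge_dir j \<bullet> \<theta>))"
    by (rule hessian_ridge_sum[OF _ neg_logpost_ridge_sum neg_logpost_derivs(1,2) \<theta>]) (use A in auto)
  also have "\<dots> = hessian (neg_loglik h A Y) \<theta> + diag_powr p (2 * \<gamma>)"
  proof (rule eq_matI, goal_cases)
    case (1 b c)
    then have bc: "b < p" "c < p" using diag_powr_carrier[of p "2 * \<gamma>"] by auto
    have "(\<Sum>k<p. unit_vec p k $ b * unit_vec p k $ c * real (Suc k) powr (2 * \<gamma>)) =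
        (\<Sum>k<p. if k = b then (if b = c then real (Suc b) powr (2 * \<gamma>) else 0) else 0)"
      using bc by (intro sum.cong) auto
    also have "\<dots> = diag_powr p (2 * \<gamma>) $$ (b, c)"
      using bc by (auto simp: diag_powr_def mat_diag_def)
    finally show ?case
      using bc diag_powr_carrier[of p "2 * \<gamma>"]
      by (simp add: sum.Plus hessian_neg_loglik[OF \<theta>])
  qed (use diag_powr_carrier[of p "2 * \<gamma>"] in auto)
  finally show ?thesis .
qed

text \<open>The profiles of the penalty are quadratic, so their third derivatives vanish and only
  the design points contribute.\<close>

lemma deriv3_neg_logpost:
  assumes "\<theta> \<in> carrier_vec p" "u \<in> carrier_vec p" "v \<in> carrier_vec p" "w \<in> carrier_vec p"
  shows "deriv3 (neg_logpost h \<gamma> A Y) \<theta> u v w =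
    (\<Sum>j<n. (deriv ^^ 3) h (row A j \<bullet> \<theta>) * ((row A j \<bullet> u) * (row A j \<bullet> v) * (row A j \<bullet> w)))"
proof -
  have "deriv3 (neg_logpost h \<gamma> A Y) \<theta> u v w = (\<Sum>j\<in>{..<n} <+> {..<p}.
      case_sum (\<lambda>j. (deriv ^^ 3) h) (\<lambda>k s. 0) j (ridge_dir j \<bullet> \<theta>) *
      ((ridge_dir j \<bullet> u) * (ridge_dir j \<bullet> v) * (ridge_dir j \<bullet> w)))"
    by (rule deriv3_ridge_sum[OF _ neg_logpost_ridge_sum neg_logpost_derivs assms]) (use A in auto)
  then show ?thesis by (simp add: sum.Plus)
qed

end

end

subsection \<open>Power sums split at the cutoff\<close>

text \<open>Comparison of (x + 1)^(-s) with the integral of t^(-s) over [x, x + 1], by the mean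
  value theorem. The right side telescopes in x.\<close>

lemma powr_Suc_diff_ge:
  fixes s x :: real
  assumes "1 < s" "0 < x"
  shows "(x + 1) powr (- s) \<le> (x powr (1 - s) - (x + 1) powr (1 - s)) / (s - 1)"
proof -
  have "\<exists>z>x. z < x + 1 \<and> (x + 1) powr (1 - s) - x powr (1 - s) = (x + 1 - x) * ((1 - s) * z powr (1 - s - 1))"
    using assms by (intro MVT2 has_real_derivative_powr) auto
  then obtain z where z: "x < z" "z < x + 1" "(x + 1) powr (1 - s) - x powr (1 - s) = (1 - s) * z powr (- s)"
    by auto
  have "(s - 1) * (x + 1) powr (- s) \<le> (s - 1) * z powr (- s)"
    using z assms by (intro mult_left_mono powr_mono2') auto
  also have "\<dots> = x powr (1 - s) - (x + 1) powr (1 - s)"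
    using z(3) by (simp add: algebra_simps)
  finally show ?thesis
    using assms by (simp add: pos_le_divide_eq mult.commute)
qed

text \<open>The summand 1 pays for the first term beyond \<open>m\<close>, and 1/(s - 1) for the
  integral bounding the rest. The dependence on \<open>s\<close> stays explicit because s = 1 + 1/m
  will be inserted, which is not bounded away from 1.\<close>

lemma sum_powr_tail_le:
  fixes s m :: real
  assumes s: "1 < s" and m: "1 \<le> m"
  shows "(\<Sum>k<p. if m < real (Suc k) then real (Suc k) powr (- s) else 0) \<le> (1 + 1 / (s - 1)) * m powr (1 - s)"
proof -
  let ?S = "\<lambda>p. \<Sum>k<p. if m < real (Suc k) then real (Suc k) powr (- s) else 0"
  \<comment> \<open>The induction carries along the unspent part of the integral,
    \<open>real p powr (1 - s) / (s - 1)\<close>, from the first \<open>p\<close> beyond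
    \<open>m\<close> on; before that the sum vanishes.\<close>
  have "if m < real p then ?S p \<le> (1 + 1 / (s - 1)) * m powr (1 - s) - real p powr (1 - s) / (s - 1) else ?S p = 0"
  proof (induction p)
    case 0
    then show ?case using m by simp
  next
    case (Suc p)
    consider "real (Suc p) \<le> m" | "real p \<le> m" "m < real (Suc p)" | "m < real p" by linarith
    then show ?case
    proof cases
      case 1
      then have "real p \<le> m" by simp
      then show ?thesis using Suc 1 by (auto split: if_splits)
    next
      case 2
      have "real (Suc p) powr (- s) \<le> m powr (- s)"
        using 2 m s by (intro powr_mono2') auto
      also have "\<dots> \<le> m powr (1 - s)" using m by (intro powr_mono) auto
      finally have A: "real (Suc p) powr (- s) \<le> m powr (1 - s)" .
      have "real (Suc p) powr (1 - s) \<le> m powr (1 - s)"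
        using 2 m s by (intro powr_mono2') auto
      then have "0 \<le> (m powr (1 - s) - real (Suc p) powr (1 - s)) / (s - 1)" using s by simp
      then show ?thesis using Suc 2 A by (simp add: algebra_simps diff_divide_distrib)
    next
      case 3
      then have "0 < real p" using m by linarith
      from powr_Suc_diff_ge[OF s this] 3 Suc show ?thesis
        by (simp add: algebra_simps diff_divide_distrib)
    qed
  qed
  moreover have "0 \<le> real p powr (1 - s) / (s - 1)" "0 \<le> (1 + 1 / (s - 1)) * m powr (1 - s)"
    using s by auto
  ultimately show ?thesis by (auto split: if_splits)
qed

text \<open>The left side is the integral of t^b over [0, q], compared on unit intervals by the mean
  value theorem. The interval at 0 is treated apart, as the derivative of the power is used at
  positive points.\<close>

lemma sum_powr_ge:
  fixes b :: real
  assumes b: "0 \<le> b"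
  shows "real q powr (b + 1) / (b + 1) \<le> (\<Sum>k<q. real (Suc k) powr b)"
proof (induction q)
  case (Suc q)
  have "real (Suc q) powr (b + 1) - real q powr (b + 1) \<le> (b + 1) * real (Suc q) powr b"
  proof (cases "q = 0")
    case False
    have "\<exists>z>real q. z < real q + 1 \<and> (real q + 1) powr (b + 1) - real q powr (b + 1) = (real q + 1 - real q) * ((b + 1) * z powr (b + 1 - 1))"
      using False by (intro MVT2 has_real_derivative_powr) auto
    then obtain z where z: "real q < z" "z < real q + 1"
        "(real q + 1) powr (b + 1) - real q powr (b + 1) = (b + 1) * z powr b"
      by auto
    have "(b + 1) * z powr b \<le> (b + 1) * (real q + 1) powr b"
      using z b by (intro mult_left_mono powr_mono2) auto
    then show ?thesis using z(3) by (simp add: add.commute)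
  qed (use b in simp)
  then have "real (Suc q) powr (b + 1) / (b + 1) \<le> (real q powr (b + 1) + (b + 1) * real (Suc q) powr b) / (b + 1)"
    using b by (intro divide_right_mono) auto
  then have "real (Suc q) powr (b + 1) / (b + 1) \<le> real q powr (b + 1) / (b + 1) + real (Suc q) powr b"
    using b by (simp add: add_divide_distrib)
  then show ?case using Suc by simp
qed simp

lemma card_Suc_le:
  assumes "1 \<le> m"
  shows "real (card {k. k < p \<and> real (Suc k) \<le> m}) \<le> min m (real p)"
proof -
  have "{k. k < p \<and> real (Suc k) \<le> m} \<subseteq> {..<nat \<lfloor>m\<rfloor>}"
    using le_nat_floor[of "Suc _" m] by (auto simp: Suc_le_eq simp del: of_nat_Suc)
  then have "card {k. k < p \<and> real (Suc k) \<le> m} \<le> nat \<lfloor>m\<rfloor>"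
    using card_mono[of "{..<nat \<lfloor>m\<rfloor>}"] by fastforce
  moreover have "real (nat \<lfloor>m\<rfloor>) \<le> m" using assms by simp
  moreover have "card {k. k < p \<and> real (Suc k) \<le> m} \<le> p"
    using card_mono[of "{..<p}" "{k. k < p \<and> real (Suc k) \<le> m}"] by fastforce
  ultimately show ?thesis by linarith
qed

text \<open>The common pattern of the upper bounds for sums over k: a bounded head with at most
  \<open>min m (real p)\<close> terms, then a power tail. The tail is nonempty only if
  \<open>m < real p\<close>, and then the minimum is \<open>m\<close>; hence \<open>T\<close> has to
  control it only in that case.\<close>

lemma sum_head_tail_le:
  fixes f :: "nat \<Rightarrow> real"
  assumes s: "1 < s" and m: "1 \<le> m" and AB: "0 \<le> A" "0 \<le> B" "0 \<le> T"
    and head: "\<And>k. k < p \<Longrightarrow> real (Suc k) \<le> m \<Longrightarrow> f k \<le> A"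
    and tail: "\<And>k. k < p \<Longrightarrow> m < real (Suc k) \<Longrightarrow> f k \<le> B * real (Suc k) powr (- s)"
    and T: "m < real p \<Longrightarrow> B * ((1 + 1 / (s - 1)) * m powr (1 - s)) \<le> T * m"
  shows "(\<Sum>k<p. f k) \<le> (A + T) * min m (real p)"
proof -
  let ?t = "\<lambda>k. if m < real (Suc k) then real (Suc k) powr (- s) else 0"
  have "(\<Sum>k<p. f k) \<le> (\<Sum>k<p. (if real (Suc k) \<le> m then A else 0) + B * ?t k)"
    using head tail by (intro sum_mono) auto
  also have "\<dots> = A * real (card {k. k < p \<and> real (Suc k) \<le> m}) + B * (\<Sum>k<p. ?t k)"
  proof -
    have "(\<Sum>k<p. if real (Suc k) \<le> m then A else 0) = (\<Sum>k\<in>{k \<in> {..<p}. real (Suc k) \<le> m}. A)"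
      by (rule sum.inter_filter[symmetric]) simp
    then show ?thesis by (simp add: sum.distrib sum_distrib_left)
  qed
  also have "\<dots> \<le> A * min m (real p) + T * min m (real p)"
  proof (intro add_mono mult_left_mono card_Suc_le m AB)
    show "B * (\<Sum>k<p. ?t k) \<le> T * min m (real p)"
    proof (cases "m < real p")
      case True
      have "B * (\<Sum>k<p. ?t k) \<le> B * ((1 + 1 / (s - 1)) * m powr (1 - s))"
        by (intro mult_left_mono sum_powr_tail_le s m AB)
      then show ?thesis using T True by simp
    next
      case False
      then have "(\<Sum>k<p. ?t k) = 0" by (intro sum.neutral) auto
      then show ?thesis using AB False m by simp
    qed
  qed
  finally show ?thesis by (simp add: distrib_right)
qed

text \<open>The exponents already contain the factor 2: \<open>b\<close> will be 2 \<beta>, and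
  \<open>g\<close> will be 2 \<gamma> or 2 \<gamma>0.\<close>

definition weight :: "real \<Rightarrow> real \<Rightarrow> real \<Rightarrow> nat \<Rightarrow> real" where
  "weight N b g k = N * real (Suc k) powr (- b) + real (Suc k) powr g"

lemma weight_pos: "0 \<le> N \<Longrightarrow> 0 < weight N b g k"
  by (auto simp: weight_def intro: add_nonneg_pos)

text \<open>Factoring out k^(-b) lets the decay of the eigenvalues cancel in the quotient of
  eigenvalue and weight, leaving 1/(N + k^(b + g)).\<close>

lemma weight_eq: "weight N b g k = real (Suc k) powr (- b) * (N + real (Suc k) powr (b + g))"
  by (simp add: weight_def algebra_simps powr_add[symmetric])

text \<open>The rounded cutoff is at least 1 and loses at most a factor 2 against the minimum of
  \<open>m\<close> and \<open>p\<close>, so it can serve as an actual index.\<close>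

lemma min_floor_ge:
  assumes "1 \<le> m" "1 \<le> p"
  shows "min m (real p) / 2 \<le> real (min (nat \<lfloor>m\<rfloor>) p)" "1 \<le> min (nat \<lfloor>m\<rfloor>) p"
    "real (min (nat \<lfloor>m\<rfloor>) p) \<le> min m (real p)"
proof -
  have 1: "1 \<le> nat \<lfloor>m\<rfloor>" using assms le_nat_floor[of 1 m] by simp
  then show "1 \<le> min (nat \<lfloor>m\<rfloor>) p" using assms by simp
  have 2: "m \<le> real (nat \<lfloor>m\<rfloor>) + 1" using assms by linarith
  have 3: "real (nat \<lfloor>m\<rfloor>) \<le> m" using assms by simp
  show "real (min (nat \<lfloor>m\<rfloor>) p) \<le> min m (real p)" using 3 by (auto simp: min_def)
  show "min m (real p) / 2 \<le> real (min (nat \<lfloor>m\<rfloor>) p)" using 1 2 assms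
    by (simp add: of_nat_min min_def del: of_nat_nat) linarith
qed

section \<open>Sums and minima of the weights around the cutoff\<close>

context
  fixes N b g m :: real
  assumes N: "1 \<le> N" and b: "0 \<le> b" and bg: "1 < b + g"
    and m_def: "m = N powr (1 / (b + g))"
begin

lemma cutoff_ge_1: "1 \<le> m"
  using N bg by (simp add: m_def ge_one_powr_ge_zero)

lemma cutoff_powr: "m powr (b + g) = N"
  using N bg by (simp add: m_def powr_powr)

text \<open>By \<open>cutoff_powr\<close> the tail bound m^(1 - b - g) equals m/N, the same order as
  a head of m terms of size 1/N.\<close>

lemma sum_inverse_le:
  "(\<Sum>k<p. 1 / (N + real (Suc k) powr (b + g))) \<le> (2 + 1 / (b + g - 1)) * (min m (real p) / N)"
proof -
  have "(\<Sum>k<p. 1 / (N + real (Suc k) powr (b + g))) \<le> (1 / N + (1 + 1 / (b + g - 1)) / N) * min m (real p)"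
  proof (rule sum_head_tail_le[OF bg cutoff_ge_1, where B = 1])
    show "1 / (N + real (Suc k) powr (b + g)) \<le> 1 / N" for k
      using N by (intro divide_left_mono) (auto intro!: mult_pos_pos add_pos_nonneg)
    show "1 / (N + real (Suc k) powr (b + g)) \<le> 1 * real (Suc k) powr - (b + g)" for k
    proof -
      have "1 / (N + real (Suc k) powr (b + g)) \<le> 1 / real (Suc k) powr (b + g)"
        using N by (intro divide_left_mono) (auto intro!: mult_pos_pos add_pos_nonneg)
      then show ?thesis by (simp only: powr_minus_divide mult_1_left)
    qed
    have "m powr (1 - (b + g)) = m / N"
      using cutoff_powr cutoff_ge_1 by (simp add: powr_diff)
    then show "1 * ((1 + 1 / (b + g - 1)) * m powr (1 - (b + g))) \<le> (1 + 1 / (b + g - 1)) / N * m" by simp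
  qed (use N bg in auto)
  also have "\<dots> = (2 + 1 / (b + g - 1)) * (min m (real p) / N)"
    by (simp add: add_divide_distrib distrib_right)
  finally show ?thesis .
qed

lemma powr_le_of_le_cutoff:
  assumes "0 < x" "x \<le> m"
  shows "x powr g \<le> N * x powr (- b)"
proof -
  have "x powr (b + g) \<le> m powr (b + g)" using assms bg by (intro powr_mono2) auto
  then have "x powr (b + g) * x powr (- b) \<le> N * x powr (- b)"
    unfolding cutoff_powr by (intro mult_right_mono) auto
  then show ?thesis by (simp add: powr_add[symmetric])
qed

text \<open>Up to the cutoff the decreasing summand decides, beyond it the penalty, which is at
  least m^g = N m^(-b). This is the smallest eigenvalue of the diagonal model, up to a
  constant.\<close>

lemma weight_ge:
  assumes "0 \<le> g" "k < p"
  shows "N * min m (real p) powr (- b) \<le> weight N b g k"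
proof (cases "real (Suc k) \<le> m")
  case True
  then have "real (Suc k) \<le> min m (real p)" using assms by auto
  then have "min m (real p) powr (- b) \<le> real (Suc k) powr (- b)"
    using b by (intro powr_mono2') auto
  then have "N * min m (real p) powr (- b) \<le> N * real (Suc k) powr (- b)" using N by (intro mult_left_mono) auto
  then show ?thesis unfolding weight_def by (smt (verit) powr_ge_zero)
next
  case False
  then have "min m (real p) = m" using assms by auto
  moreover have "N * m powr (- b) = m powr g"
    using cutoff_ge_1 by (simp add: cutoff_powr[symmetric] powr_add[symmetric])
  moreover have "m powr g \<le> real (Suc k) powr g"
    using False cutoff_ge_1 assms by (intro powr_mono2) auto
  ultimately show ?thesis using N by (simp add: weight_def add_increasing)
qed

lemma weight_le_of_le_cutoff:
  assumes "real (Suc k) \<le> m"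
  shows "weight N b g k \<le> 2 * N * real (Suc k) powr (- b)"
  using powr_le_of_le_cutoff[of "real (Suc k)"] assms by (simp add: weight_def)

text \<open>The last index under the cutoff attains the bound of \<open>weight_ge\<close> up to a
  constant: 2 for the two summands, \<open>2 powr b\<close> for rounding. The \<open>- 1\<close>
  compensates the index shift in \<open>weight\<close>.\<close>

lemma weight_floor_le:
  assumes "1 \<le> p"
  shows "weight N b g (min (nat \<lfloor>m\<rfloor>) p - 1) \<le> 2 * 2 powr b * N * min m (real p) powr (- b)"
proof -
  define q where "q = min (nat \<lfloor>m\<rfloor>) p"
  note q = min_floor_ge[OF cutoff_ge_1 assms, folded q_def]
  have S: "Suc (q - 1) = q" using q by simp
  have "weight N b g (q - 1) \<le> 2 * N * real q powr (- b)"
    using weight_le_of_le_cutoff[of "q - 1"] q unfolding S by simp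
  also have "\<dots> \<le> 2 * N * (min m (real p) / 2) powr (- b)"
    using q N b assms cutoff_ge_1 by (intro mult_left_mono powr_mono2') auto
  also have "\<dots> = 2 * 2 powr b * N * min m (real p) powr (- b)"
    using cutoff_ge_1 by (simp add: powr_divide powr_minus field_simps)
  finally show ?thesis by (simp add: q_def)
qed

text \<open>This models the trace of G^-2. Head terms are at most (min m p)^b / N; the tail is
  summable since g > 1 and has order m^(1 - g) = m^(b + 1) / N.\<close>

lemma sum_inverse_weight_le:
  assumes "1 < g"
  shows "(\<Sum>k<p. 1 / weight N b g k) \<le> (2 + 1 / (g - 1)) * (min m (real p) powr (b + 1) / N)"
proof -
  let ?\<mu> = "min m (real p)"
  have "(\<Sum>k<p. 1 / weight N b g k) \<le> (?\<mu> powr b / N + (1 + 1 / (g - 1)) * (?\<mu> powr b / N)) * ?\<mu>"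
  proof (rule sum_head_tail_le[OF assms cutoff_ge_1, where B = 1])
    show "1 / weight N b g k \<le> ?\<mu> powr b / N" if "k < p" "real (Suc k) \<le> m" for k
    proof -
      have "1 / weight N b g k \<le> 1 / (N * real (Suc k) powr (- b))"
        using N by (intro divide_left_mono mult_pos_pos weight_pos) (auto simp: weight_def)
      also have "\<dots> = real (Suc k) powr b / N" by (simp add: powr_minus field_simps)
      also have "\<dots> \<le> ?\<mu> powr b / N" using that N b by (intro divide_right_mono powr_mono2) auto
      finally show ?thesis .
    qed
    show "1 / weight N b g k \<le> 1 * real (Suc k) powr - g" for k
    proof -
      have "1 / weight N b g k \<le> 1 / real (Suc k) powr g"
        using N by (intro divide_left_mono mult_pos_pos weight_pos) (auto simp: weight_def)
      then show ?thesis by (simp only: powr_minus_divide mult_1_left)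
    qed
    show "1 * ((1 + 1 / (g - 1)) * m powr (1 - g)) \<le> (1 + 1 / (g - 1)) * (?\<mu> powr b / N) * m" if "m < real p"
    proof -
      have "m powr (1 - g) = m powr b / N * m"
        using cutoff_ge_1 by (simp add: cutoff_powr[symmetric] powr_diff powr_add)
      then show ?thesis using that by (simp add: min_def)
    qed
  qed (use assms N in auto)
  also have "\<dots> = (2 + 1 / (g - 1)) * (?\<mu> powr (b + 1) / N)"
    using cutoff_ge_1 by (simp add: powr_add algebra_simps add_divide_distrib)
  finally show ?thesis .
qed

text \<open>Below the cutoff an inverse weight is at least k^b / (2 N), and
  \<open>sum_powr_ge\<close> adds these up. Rounding the cutoff costs \<open>2 powr (b + 1)\<close>,
  the weights another 2.\<close>

lemma sum_inverse_weight_ge: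
  assumes "1 \<le> p"
  shows "min m (real p) powr (b + 1) / N \<le> 2 powr (b + 2) * (b + 1) * (\<Sum>k<p. 1 / weight N b g k)"
proof -
  define q where "q = min (nat \<lfloor>m\<rfloor>) p"
  note q = min_floor_ge[OF cutoff_ge_1 assms, folded q_def]
  let ?\<mu> = "min m (real p)"
  have "(?\<mu> / 2) powr (b + 1) / (b + 1) \<le> real q powr (b + 1) / (b + 1)"
    using q b cutoff_ge_1 by (intro divide_right_mono powr_mono2) auto
  also have "\<dots> \<le> (\<Sum>k<q. real (Suc k) powr b)" by (rule sum_powr_ge[OF b])
  also have "\<dots> \<le> (\<Sum>k<q. 2 * N * (1 / weight N b g k))"
  proof (rule sum_mono)
    fix k assume "k \<in> {..<q}"
    then have "real (Suc k) \<le> m" using q by auto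
    then have "weight N b g k \<le> 2 * N * real (Suc k) powr (- b)" by (rule weight_le_of_le_cutoff)
    then have "weight N b g k * real (Suc k) powr b \<le> 2 * N * real (Suc k) powr (- b) * real (Suc k) powr b"
      by (intro mult_right_mono) auto
    also have "\<dots> = 2 * N" by (simp add: powr_add[symmetric] mult.assoc)
    finally show "real (Suc k) powr b \<le> 2 * N * (1 / weight N b g k)"
      using weight_pos[of N b g k] N by (simp add: pos_le_divide_eq mult.commute)
  qed
  also have "\<dots> = 2 * N * (\<Sum>k<q. 1 / weight N b g k)" by (simp add: sum_distrib_left)
  also have "\<dots> \<le> 2 * N * (\<Sum>k<p. 1 / weight N b g k)"
    using N weight_pos[of N b g] by (intro mult_left_mono sum_mono2) (auto simp: q_def less_imp_le)
  finally have le: "(?\<mu> / 2) powr (b + 1) / (b + 1) \<le> 2 * N * (\<Sum>k<p. 1 / weight N b g k)" .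
  have "?\<mu> powr (b + 1) / N = (?\<mu> / 2) powr (b + 1) / (b + 1) * (2 powr (b + 1) * (b + 1) / N)"
    using cutoff_ge_1 b by (simp add: powr_divide)
  also have "\<dots> \<le> 2 * N * (\<Sum>k<p. 1 / weight N b g k) * (2 powr (b + 1) * (b + 1) / N)"
    using N b by (intro mult_right_mono le) auto
  also have "\<dots> = 2 powr (b + 2) * (b + 1) * (\<Sum>k<p. 1 / weight N b g k)"
    using N by (simp add: powr_add)
  finally show ?thesis .
qed

context
  fixes g0 :: real
  assumes g0: "g0 = g - 1 - 1 / m"
begin

lemma sum_weight_ratio_le:
  "(\<Sum>k<p. weight N b g0 k / weight N b g k) \<le> (4 + 1 / (b + g - 1)) * min m (real p)"
proof -
  \<comment> \<open>For k > m the ratio is at most N k^(-b - g) + k^(-1 - 1/m). Since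
    \<open>sum_head_tail_le\<close> admits a single power, the second one is split off and summed
    with its own exponent.\<close>
  let ?f2 = "\<lambda>k. if m < real (Suc k) then real (Suc k) powr (- (1 + 1 / m)) else 0"
  let ?f1 = "\<lambda>k. weight N b g0 k / weight N b g k - ?f2 k"
  have "0 \<le> 1 / m" using cutoff_ge_1 by simp
  then have le: "g0 \<le> g" using g0 by linarith
  have "(\<Sum>k<p. ?f1 k) \<le> (1 + (1 + 1 / (b + g - 1))) * min m (real p)"
  proof (rule sum_head_tail_le[OF bg cutoff_ge_1, where B = N])
    show "?f1 k \<le> 1" if "real (Suc k) \<le> m" for k
      using that weight_pos[of N b g k] N powr_mono[OF le, of "real (Suc k)"] by (simp add: weight_def)
    show "?f1 k \<le> N * real (Suc k) powr - (b + g)" if "m < real (Suc k)" for k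
    proof -
      have "weight N b g0 k / weight N b g k \<le> weight N b g0 k / real (Suc k) powr g"
        using N weight_pos[of N b g k] weight_pos[of N b g0 k]
        by (intro divide_left_mono mult_pos_pos) (auto simp: weight_def)
      also have "\<dots> = N * real (Suc k) powr - (b + g) + real (Suc k) powr (- (1 + 1 / m))"
        by (simp add: weight_def g0 powr_diff powr_minus powr_add field_simps)
      finally show ?thesis using that by simp
    qed
    have "m powr (1 - (b + g)) = m / N"
      using cutoff_powr cutoff_ge_1 by (simp add: powr_diff)
    then show "N * ((1 + 1 / (b + g - 1)) * m powr (1 - (b + g))) \<le> (1 + 1 / (b + g - 1)) * m"
      using N by simp
  qed (use N bg in auto)
  moreover have "(\<Sum>k<p. ?f2 k) \<le> (0 + 2) * min m (real p)"
  proof (rule sum_head_tail_le[OF _ cutoff_ge_1, where B = 1 and s = "1 + 1 / m"])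
    have "m powr (1 - (1 + 1 / m)) \<le> m powr 0"
      using cutoff_ge_1 by (intro powr_mono) auto
    then have "(1 + m) * m powr (1 - (1 + 1 / m)) \<le> (1 + m) * 1"
      using cutoff_ge_1 by (intro mult_left_mono) auto
    also have "\<dots> \<le> 2 * m" using cutoff_ge_1 by simp
    finally show "1 * ((1 + 1 / (1 + 1 / m - 1)) * m powr (1 - (1 + 1 / m))) \<le> 2 * m"
      using cutoff_ge_1 by simp
  qed (use cutoff_ge_1 in auto)
  ultimately show ?thesis by (simp add: sum_subtractf algebra_simps)
qed

text \<open>Both weights contain N k^(-b), which below the cutoff is at least half of the
  denominator; so each of these ratios is at least 1/2.\<close>

lemma sum_weight_ratio_ge:
  assumes "1 \<le> p"
  shows "min m (real p) \<le> 4 * (\<Sum>k<p. weight N b g0 k / weight N b g k)"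
proof -
  define q where "q = min (nat \<lfloor>m\<rfloor>) p"
  note q = min_floor_ge[OF cutoff_ge_1 assms, folded q_def]
  have "real q / 2 = (\<Sum>k<q. 1 / 2)" by simp
  also have "\<dots> \<le> (\<Sum>k<q. weight N b g0 k / weight N b g k)"
  proof (rule sum_mono)
    fix k assume "k \<in> {..<q}"
    then have "real (Suc k) \<le> m" using q by auto
    then have "weight N b g k \<le> 2 * N * real (Suc k) powr (- b)" by (rule weight_le_of_le_cutoff)
    also have "\<dots> \<le> 2 * weight N b g0 k" by (simp add: weight_def)
    finally show "1 / 2 \<le> weight N b g0 k / weight N b g k"
      using weight_pos[of N b g k] N by (simp add: pos_le_divide_eq)
  qed
  also have "\<dots> \<le> (\<Sum>k<p. weight N b g0 k / weight N b g k)"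
    using N weight_pos[of N b] by (intro sum_mono2) (auto simp: q_def less_imp_le)
  finally show ?thesis using q by simp
qed

end

end

subsection \<open>Effective dimensions and third derivatives under diagonal bounds\<close>

lemma vnorm_scaled_one: "vnorm (((1 / x) \<cdot>\<^sub>m 1\<^sub>m p) *\<^sub>v u) = vnorm u / \<bar>x\<bar>" if "u \<in> carrier_vec p"
proof -
  have "((1 / x) \<cdot>\<^sub>m 1\<^sub>m p) *\<^sub>v u = (1 / x) \<cdot>\<^sub>v u"
    using that by (intro eq_vecI) (auto simp: scalar_prod_def sum_divide_distrib[symmetric] if_distrib[of "\<lambda>y. y * _"] cong: if_cong)
  then show ?thesis by (simp add: vnorm_smult)
qed

section \<open>Effective dimensions of a matrix whose square is comparable to the weights\<close>

context
  fixes N b g m c C :: real and p :: nat and G :: "real mat"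
  assumes N: "1 \<le> N" and b: "0 \<le> b" and bg: "1 < b + g"
    and m_def: "m = N powr (1 / (b + g))"
    and p: "1 \<le> p" and c: "0 < c" and C: "0 < C"
    and G: "sym_pos_def p G"
    and wG: "\<And>u. u \<in> carrier_vec p \<Longrightarrow> c * (\<Sum>k<p. weight N b g k * (u $ k)\<^sup>2) \<le> (vnorm (G *\<^sub>v u))\<^sup>2"
      "\<And>u. u \<in> carrier_vec p \<Longrightarrow> (vnorm (G *\<^sub>v u))\<^sup>2 \<le> C * (\<Sum>k<p. weight N b g k * (u $ k)\<^sup>2)"
begin

lemma weight_pos_N: "0 < weight N b g k"
  using N by (intro weight_pos) simp

lemma eff_dim_dominated:
  assumes D: "D \<in> carrier_mat p p" "transpose_mat D = D"
    and g0: "g0 = g - 1 - 1 / m"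
    and wD: "\<And>u. u \<in> carrier_vec p \<Longrightarrow> c * (\<Sum>k<p. weight N b g0 k * (u $ k)\<^sup>2) \<le> (vnorm (D *\<^sub>v u))\<^sup>2"
      "\<And>u. u \<in> carrier_vec p \<Longrightarrow> (vnorm (D *\<^sub>v u))\<^sup>2 \<le> C * (\<Sum>k<p. weight N b g0 k * (u $ k)\<^sup>2)"
    and le: "\<And>u. u \<in> carrier_vec p \<Longrightarrow> vnorm (D *\<^sub>v u) \<le> vnorm (G *\<^sub>v u)"
    and eq: "vnorm (D *\<^sub>v unit_vec p 0) = vnorm (G *\<^sub>v unit_vec p 0)"
  shows "min m (real p) \<le> 4 * C / c * eff_dim G D"
    and "eff_dim G D \<le> C / c * (4 + 1 / (b + g - 1)) * min m (real p)"
proof -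
  have le': "vnorm (D *\<^sub>v u) \<le> 1 * vnorm (G *\<^sub>v u)" if "u \<in> carrier_vec p" for u
    using le[OF that] by simp
  have "G *\<^sub>v unit_vec p 0 \<noteq> 0\<^sub>v p"
  proof
    assume "G *\<^sub>v unit_vec p 0 = 0\<^sub>v p"
    then have "mat_inv G *\<^sub>v 0\<^sub>v p = unit_vec p 0"
      using sym_pos_def_inverse_vec(2)[OF G, of "unit_vec p 0"] by simp
    moreover have "mat_inv G *\<^sub>v 0\<^sub>v p = 0\<^sub>v p"
      using sym_pos_def_inverse(1)[OF G] by auto
    ultimately have "unit_vec p 0 = (0\<^sub>v p :: real vec)" by simp
    from arg_cong[OF this, of "\<lambda>v. v $ 0"] show False using p by simp
  qed
  then have pos: "0 < vnorm (G *\<^sub>v unit_vec p 0)"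
    using G by (intro vnorm_pos) (auto simp: sym_pos_def_def)
  \<comment> \<open>The two forms agree at the first unit vector because \<open>1 powr s = 1\<close> for every \<open>s\<close>.\<close>
  have "alpha G D = 1"
  proof (rule antisym)
    show "alpha G D \<le> 1" by (rule alpha_le[OF G D le' p])
    show "1 \<le> alpha G D" using alpha_ge[OF G D le', of "unit_vec p 0"] eq pos by simp
  qed
  then have eff: "eff_dim G D = trace (mat_inv G ^\<^sub>m 2 * D ^\<^sub>m 2)" by (simp add: eff_dim_def)
  have w0: "0 \<le> weight N b g0 i" for i using weight_pos[of N b g0 i] N by simp
  note tr = trace_inverse_sq_bounds[OF G D w0 weight_pos_N c C less_imp_le[OF c] less_imp_le[OF C] wD wG, folded eff]
  let ?S = "\<Sum>k<p. weight N b g0 k / weight N b g k"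
  have "min m (real p) \<le> 4 * ?S" by (rule sum_weight_ratio_ge[OF N b bg m_def g0 p])
  also have "\<dots> = 4 * C / c * (c / C * ?S)" using c C by simp
  also have "\<dots> \<le> 4 * C / c * eff_dim G D" using c C by (intro mult_left_mono tr) auto
  finally show "min m (real p) \<le> 4 * C / c * eff_dim G D" .
  have "eff_dim G D \<le> C / c * ?S" by (rule tr)
  also have "\<dots> \<le> C / c * ((4 + 1 / (b + g - 1)) * min m (real p))"
    using c C by (intro mult_left_mono sum_weight_ratio_le[OF N b bg m_def g0]) auto
  finally show "eff_dim G D \<le> C / c * (4 + 1 / (b + g - 1)) * min m (real p)" by (simp add: mult.assoc)
qed

lemma mu_pos: "0 < min m (real p)"
  using cutoff_ge_1[OF N b bg m_def] p by simp

text \<open>A lower bound for the smallest eigenvalue of G^2, from \<open>weight_ge\<close>. The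
  identity matrix is written out so that the statement instantiates the hypothesis of
  \<open>alpha_le\<close> and \<open>alpha_ge\<close>.\<close>

lemma vnorm_le_vnorm_mult:
  assumes g: "0 \<le> g" and u: "u \<in> carrier_vec p"
  shows "vnorm (1\<^sub>m p *\<^sub>v u) \<le> sqrt (min m (real p) powr b / (c * N)) * vnorm (G *\<^sub>v u)"
proof -
  let ?\<mu> = "min m (real p)"
  have "c * (N * ?\<mu> powr (- b)) * (vnorm u)\<^sup>2 = c * (\<Sum>k<p. (N * ?\<mu> powr (- b)) * (u $ k)\<^sup>2)"
    by (simp add: vnorm_sq_sum[OF u] sum_distrib_left mult.assoc)
  also have "\<dots> \<le> c * (\<Sum>k<p. weight N b g k * (u $ k)\<^sup>2)"
    using c weight_ge[OF N b bg m_def g] by (intro mult_left_mono sum_mono mult_right_mono) auto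
  also have "\<dots> \<le> (vnorm (G *\<^sub>v u))\<^sup>2" by (rule wG[OF u])
  finally have "(vnorm u)\<^sup>2 \<le> ?\<mu> powr b / (c * N) * (vnorm (G *\<^sub>v u))\<^sup>2"
    using c N mu_pos by (simp add: powr_minus field_simps)
  then have "sqrt ((vnorm u)\<^sup>2) \<le> sqrt (?\<mu> powr b / (c * N) * (vnorm (G *\<^sub>v u))\<^sup>2)"
    by (rule real_sqrt_le_mono)
  then show ?thesis
    using u by (simp only: real_sqrt_mult[of _ "_\<^sup>2"] real_sqrt_abs abs_of_nonneg[OF vnorm_nonneg] one_mult_mat_vec)
qed

text \<open>The square of \<open>alpha\<close> of the identity is the inverse of the smallest
  eigenvalue of G^2. The preceding lemma bounds it from above; from below it suffices to test the
  unit vector at the nearly minimal weight of \<open>weight_floor_le\<close>.\<close>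

lemma alpha_one_bounds:
  assumes g: "0 \<le> g"
  shows "0 < alpha G (1\<^sub>m p)"
    and "(alpha G (1\<^sub>m p))\<^sup>2 \<le> min m (real p) powr b / (c * N)"
    and "min m (real p) powr b / (2 * 2 powr b * C * N) \<le> (alpha G (1\<^sub>m p))\<^sup>2"
proof -
  let ?\<mu> = "min m (real p)" and ?a = "alpha G (1\<^sub>m p)"
  have I: "1\<^sub>m p \<in> carrier_mat p p" "transpose_mat (1\<^sub>m p) = (1\<^sub>m p :: real mat)" by auto
  define k where "k = min (nat \<lfloor>m\<rfloor>) p - 1"
  have k: "k < p" using p by (auto simp: k_def)
  have "vnorm (1\<^sub>m p *\<^sub>v unit_vec p k) \<le> ?a * vnorm (G *\<^sub>v unit_vec p k)"
    by (rule alpha_ge[OF G I vnorm_le_vnorm_mult[OF g]]) auto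
  then have ge: "1 \<le> ?a * vnorm (G *\<^sub>v unit_vec p k)" using k by (simp add: vnorm_unit_vec)
  show a: "0 < ?a"
  proof (rule ccontr)
    assume "\<not> 0 < ?a"
    then have "?a * vnorm (G *\<^sub>v unit_vec p k) \<le> 0"
      using vnorm_nonneg by (simp add: mult_nonpos_nonneg)
    then show False using ge by simp
  qed
  have "?a \<le> sqrt (?\<mu> powr b / (c * N))"
    by (rule alpha_le[OF G I vnorm_le_vnorm_mult[OF g] p]) auto
  then have "?a\<^sup>2 \<le> (sqrt (?\<mu> powr b / (c * N)))\<^sup>2" using a by (intro power_mono) auto
  then show "?a\<^sup>2 \<le> ?\<mu> powr b / (c * N)" using c N by simp
  have "1 \<le> (?a * vnorm (G *\<^sub>v unit_vec p k))\<^sup>2" using ge by (simp add: one_le_power)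
  also have "\<dots> \<le> ?a\<^sup>2 * (C * (\<Sum>i<p. weight N b g i * (unit_vec p k $ i)\<^sup>2))"
    unfolding power_mult_distrib by (intro mult_left_mono wG) auto
  also have "(\<Sum>i<p. weight N b g i * ((unit_vec p k :: real vec) $ i)\<^sup>2) = (\<Sum>i<p. if i = k then weight N b g k else 0)"
    using k by (intro sum.cong) auto
  also have "\<dots> = weight N b g k" using k by simp
  also have "?a\<^sup>2 * (C * weight N b g k) \<le> ?a\<^sup>2 * (C * (2 * 2 powr b * N * ?\<mu> powr (- b)))"
    using C weight_floor_le[OF N b bg m_def p] by (intro mult_left_mono) (auto simp: k_def)
  finally show "?\<mu> powr b / (2 * 2 powr b * C * N) \<le> ?a\<^sup>2"
    using C N mu_pos by (simp add: powr_minus field_simps)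
qed

text \<open>After the scaling \<open>alpha\<close> is 1, so the effective dimension is the trace of
  G^-2 over the squared \<open>alpha\<close> of the identity. With \<mu> the minimum of m and p, the
  orders are \<mu>^(b + 1) / N and \<mu>^b / N, and their quotient is \<mu>.\<close>

lemma eff_dim_scaled_one:
  assumes g: "1 < g"
  defines "D \<equiv> (1 / alpha G (1\<^sub>m p)) \<cdot>\<^sub>m 1\<^sub>m p"
  shows "min m (real p) \<le> 2 powr (b + 2) * (b + 1) * C / c * eff_dim G D"
    and "eff_dim G D \<le> 2 * 2 powr b * C / c * (2 + 1 / (g - 1)) * min m (real p)"
proof -
  let ?\<mu> = "min m (real p)" and ?a = "alpha G (1\<^sub>m p)"
  have g': "0 \<le> g" using g by simp
  note al = alpha_one_bounds[OF g']
  have I: "1\<^sub>m p \<in> carrier_mat p p" "transpose_mat (1\<^sub>m p) = (1\<^sub>m p :: real mat)" by auto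
  have D: "D \<in> carrier_mat p p" "transpose_mat D = D"
    by (auto simp: D_def intro!: eq_matI)
  have ge: "vnorm u \<le> ?a * vnorm (G *\<^sub>v u)" if u: "u \<in> carrier_vec p" for u
    using alpha_ge[OF G I vnorm_le_vnorm_mult[OF g'], of u] u by simp
  have vD: "vnorm (D *\<^sub>v u) = vnorm u / ?a" if "u \<in> carrier_vec p" for u
    using vnorm_scaled_one[OF that, of ?a] al(1) by (simp add: D_def)
  have le: "vnorm (D *\<^sub>v u) \<le> 1 * vnorm (G *\<^sub>v u)" if u: "u \<in> carrier_vec p" for u
    using ge[OF u] al(1) by (simp add: vD[OF u] pos_divide_le_eq mult.commute)
  have "alpha G D = 1"
  proof (rule antisym)
    show "alpha G D \<le> 1" by (rule alpha_le[OF G D le p])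
    \<comment> \<open>Homogeneity through the extremal property: a constant admissible for
      \<open>D\<close> becomes admissible for the identity when multiplied by
      \<open>?a\<close>.\<close>
    have "vnorm (1\<^sub>m p *\<^sub>v u) \<le> (?a * alpha G D) * vnorm (G *\<^sub>v u)" if u: "u \<in> carrier_vec p" for u
      using alpha_ge[OF G D le u] al(1) u by (simp add: vD[OF u] pos_divide_le_eq mult_ac)
    then have "?a \<le> ?a * alpha G D" by (rule alpha_le[OF G I _ p])
    then show "1 \<le> alpha G D" using al(1) by simp
  qed
  then have eff: "eff_dim G D = trace (mat_inv G ^\<^sub>m 2 * D ^\<^sub>m 2)" by (simp add: eff_dim_def)
  have "(vnorm (D *\<^sub>v u))\<^sup>2 = (1 / ?a\<^sup>2) * (\<Sum>k<p. 1 * (u $ k)\<^sup>2)" if u: "u \<in> carrier_vec p" for u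
    by (simp add: vD[OF u] power_divide vnorm_sq_sum[OF u])
  then have wD: "(1 / ?a\<^sup>2) * (\<Sum>k<p. 1 * (u $ k)\<^sup>2) \<le> (vnorm (D *\<^sub>v u))\<^sup>2"
    "(vnorm (D *\<^sub>v u))\<^sup>2 \<le> (1 / ?a\<^sup>2) * (\<Sum>k<p. 1 * (u $ k)\<^sup>2)" if "u \<in> carrier_vec p" for u
    using that by auto
  have a0: "0 \<le> 1 / ?a\<^sup>2" by simp
  note tr = trace_inverse_sq_bounds[OF G D zero_le_one weight_pos_N c C a0 a0 wD wG, folded eff]
  let ?S = "\<Sum>k<p. 1 / weight N b g k"
  have S: "0 \<le> ?S" using weight_pos_N by (intro sum_nonneg) (auto intro: less_imp_le)
  have mb: "0 < ?\<mu> powr b" unfolding powr_gt_zero by (rule less_imp_neq[OF mu_pos, symmetric])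
  have "x = (c * N / x powr b) * (x powr (b + 1) / N) / c" if "0 < x" for x
    using that c N by (simp add: powr_add)
  then have "?\<mu> = (c * N / ?\<mu> powr b) * (?\<mu> powr (b + 1) / N) / c"
    using mu_pos by blast
  also have "\<dots> \<le> (1 / ?a\<^sup>2) * (2 powr (b + 2) * (b + 1) * ?S) / c"
  proof (intro divide_right_mono mult_mono sum_inverse_weight_ge[OF N b bg m_def p])
    show "c * N / ?\<mu> powr b \<le> 1 / ?a\<^sup>2"
      using al(1,2) c N mb by (simp add: field_simps)
  qed (use c N in auto)
  also have "\<dots> = 2 powr (b + 2) * (b + 1) * C / c * ((1 / ?a\<^sup>2) / C * ?S)"
    using C by (simp add: mult_ac)
  also have "\<dots> \<le> 2 powr (b + 2) * (b + 1) * C / c * eff_dim G D"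
    using b c C by (intro mult_left_mono tr) auto
  finally show "?\<mu> \<le> 2 powr (b + 2) * (b + 1) * C / c * eff_dim G D" .
  have "eff_dim G D \<le> (1 / ?a\<^sup>2) / c * ?S" by (rule tr)
  also have "\<dots> \<le> (2 * 2 powr b * C * N / ?\<mu> powr b) / c * ((2 + 1 / (g - 1)) * (?\<mu> powr (b + 1) / N))"
  proof (intro divide_right_mono mult_mono sum_inverse_weight_le[OF N b bg m_def g] S)
    show "1 / ?a\<^sup>2 \<le> 2 * 2 powr b * C * N / ?\<mu> powr b"
      using al(1,3) C N mb by (simp add: field_simps)
  qed (use c C N in auto)
  also have "\<dots> = 2 * 2 powr b * C / c * (2 + 1 / (g - 1)) * ?\<mu>"
  proof -
    have "(2 * 2 powr b * C * N / x powr b) / c * ((2 + 1 / (g - 1)) * (x powr (b + 1) / N))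
        = 2 * 2 powr b * C / c * (2 + 1 / (g - 1)) * x" if "0 < x" for x
      using that N c by (simp add: powr_add)
    then show ?thesis using mu_pos by blast
  qed
  finally show "eff_dim G D \<le> 2 * 2 powr b * C / c * (2 + 1 / (g - 1)) * ?\<mu>" .
qed

end

lemma eff_dim_self:
  assumes G: "sym_pos_def p G" and p: "1 \<le> p"
  shows "eff_dim G G = real p"
proof -
  have Gc: "G \<in> carrier_mat p p" "transpose_mat G = G" using G by (auto simp: sym_pos_def_def)
  have le: "vnorm (G *\<^sub>v u) \<le> 1 * vnorm (G *\<^sub>v u)" for u by simp
  have "G *\<^sub>v (mat_inv G *\<^sub>v unit_vec p 0) = unit_vec p 0"
    by (rule sym_pos_def_inverse_vec[OF G]) simp
  moreover have "vnorm (G *\<^sub>v (mat_inv G *\<^sub>v unit_vec p 0)) \<le> alpha G G * vnorm (G *\<^sub>v (mat_inv G *\<^sub>v unit_vec p 0))"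
    using sym_pos_def_inverse(1)[OF G] by (intro alpha_ge[OF G Gc le]) auto
  ultimately have "1 \<le> alpha G G" using p by (simp add: vnorm_unit_vec)
  moreover have "alpha G G \<le> 1" by (rule alpha_le[OF G Gc le p])
  ultimately have "alpha G G = 1" by simp
  moreover have "(\<Sum>i<p. (vnorm (G *\<^sub>v (mat_inv G *\<^sub>v unit_vec p i)))\<^sup>2) = (\<Sum>i<p. 1)"
    using sym_pos_def_inverse_vec(1)[OF G] by (intro sum.cong refl) (auto simp: vnorm_unit_vec)
  ultimately show ?thesis
    using trace_inverse_sq[OF G Gc] by (simp add: eff_dim_def)
qed

text \<open>The bound is the same at every \<theta> because \<open>H\<close> bounds the third
  derivative of \<open>h\<close> globally. The inequality of arithmetic and geometric means
  separates \<open>v\<close> from \<open>w\<close>, so that \<open>V\<close> is asked for one vector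
  at a time.\<close>

lemma deriv3_sup_norm_le:
  fixes A :: "real mat"
  assumes smooth: "\<forall>k s. (deriv ^^ k) h differentiable (at s)"
    and A: "A \<in> carrier_mat n p"
    and H: "\<And>t. \<bar>(deriv ^^ 3) h t\<bar> \<le> H" and X: "0 \<le> X"
    and X_le: "\<And>u j. u \<in> carrier_vec p \<Longrightarrow> vnorm (D *\<^sub>v u) = 1 \<Longrightarrow> j < n \<Longrightarrow> \<bar>row A j \<bullet> u\<bar> \<le> X"
    and V_le: "\<And>u. u \<in> carrier_vec p \<Longrightarrow> vnorm (D *\<^sub>v u) = 1 \<Longrightarrow> (\<Sum>j<n. (row A j \<bullet> u)\<^sup>2) \<le> V"
  shows "deriv3_sup_norm p D (neg_logpost h \<gamma> A Y) \<le> ereal (H * X * V)"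
  unfolding deriv3_sup_norm_def deriv3_norm_def
proof (intro SUP_least)
  fix \<theta> :: "real vec" and x
  assume \<theta>: "\<theta> \<in> carrier_vec p"
    and "x \<in> {(u, v, w). u \<in> carrier_vec (dim_vec \<theta>) \<and> v \<in> carrier_vec (dim_vec \<theta>) \<and>
      w \<in> carrier_vec (dim_vec \<theta>) \<and> vnorm (D *\<^sub>v u) = 1 \<and> vnorm (D *\<^sub>v v) = 1 \<and> vnorm (D *\<^sub>v w) = 1}"
  then obtain u v w where x: "x = (u, v, w)"
    and uvw: "u \<in> carrier_vec p" "v \<in> carrier_vec p" "w \<in> carrier_vec p"
    and n: "vnorm (D *\<^sub>v u) = 1" "vnorm (D *\<^sub>v v) = 1" "vnorm (D *\<^sub>v w) = 1" by auto
  have H0: "0 \<le> H" using H[of 0] by linarith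
  have "deriv3 (neg_logpost h \<gamma> A Y) \<theta> u v w =
      (\<Sum>j<n. (deriv ^^ 3) h (row A j \<bullet> \<theta>) * ((row A j \<bullet> u) * (row A j \<bullet> v) * (row A j \<bullet> w)))"
    by (rule deriv3_neg_logpost[OF smooth A \<theta> uvw])
  also have "\<dots> \<le> (\<Sum>j<n. H * X * (((row A j \<bullet> v)\<^sup>2 + (row A j \<bullet> w)\<^sup>2) / 2))"
  proof (rule sum_mono)
    fix j assume j: "j \<in> {..<n}"
    have vw: "\<bar>row A j \<bullet> v\<bar> * \<bar>row A j \<bullet> w\<bar> \<le> ((row A j \<bullet> v)\<^sup>2 + (row A j \<bullet> w)\<^sup>2) / 2"
      using sum_squares_bound[of "\<bar>row A j \<bullet> v\<bar>" "\<bar>row A j \<bullet> w\<bar>"] by simp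
    have "(deriv ^^ 3) h (row A j \<bullet> \<theta>) * ((row A j \<bullet> u) * (row A j \<bullet> v) * (row A j \<bullet> w))
        \<le> \<bar>(deriv ^^ 3) h (row A j \<bullet> \<theta>)\<bar> * (\<bar>row A j \<bullet> u\<bar> * (\<bar>row A j \<bullet> v\<bar> * \<bar>row A j \<bullet> w\<bar>))"
      by (rule order_trans[OF abs_ge_self]) (simp add: abs_mult)
    also have "\<dots> \<le> H * (X * (((row A j \<bullet> v)\<^sup>2 + (row A j \<bullet> w)\<^sup>2) / 2))"
      using X_le[OF uvw(1) n(1)] j H H0 X by (intro mult_mono vw) auto
    finally show "(deriv ^^ 3) h (row A j \<bullet> \<theta>) * ((row A j \<bullet> u) * (row A j \<bullet> v) * (row A j \<bullet> w))
        \<le> H * X * (((row A j \<bullet> v)\<^sup>2 + (row A j \<bullet> w)\<^sup>2) / 2)" by (simp add: mult.assoc)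
  qed
  also have "\<dots> = H * X * (((\<Sum>j<n. (row A j \<bullet> v)\<^sup>2) + (\<Sum>j<n. (row A j \<bullet> w)\<^sup>2)) / 2)"
    by (simp only: sum_distrib_left[symmetric] sum_divide_distrib[symmetric] sum.distrib)
  also have "\<dots> \<le> H * X * V"
    using V_le[OF uvw(2) n(2)] V_le[OF uvw(3) n(3)] H0 X by (intro mult_left_mono) auto
  finally show "(case x of (u, v, w) \<Rightarrow> ereal (deriv3 (neg_logpost h \<gamma> A Y) \<theta> u v w)) \<le> ereal (H * X * V)"
    by (simp add: x)
qed

text \<open>The weights are left free: the model weights are used for \<open>DG\<close> and
  \<open>D0\<close>, and constant weights 1 for the scaled identity.\<close>

lemma row_scalar_prod_sq_le:
  fixes A :: "real mat"
  assumes A: "A \<in> carrier_mat n p" and j: "j < n"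
    and entry: "\<And>k. k < p \<Longrightarrow> A $$ (j, k) = sqrt (e k) * \<psi> k"
    and e: "\<And>k. k < p \<Longrightarrow> 0 \<le> e k" and \<psi>: "\<And>k. k < p \<Longrightarrow> \<bar>\<psi> k\<bar> \<le> B"
    and w: "\<And>k. k < p \<Longrightarrow> 0 < w k" and u: "u \<in> carrier_vec p"
  shows "(row A j \<bullet> u)\<^sup>2 \<le> B\<^sup>2 * (\<Sum>k<p. e k / w k) * (\<Sum>k<p. w k * (u $ k)\<^sup>2)"
proof -
  have "row A j \<bullet> u = (\<Sum>k<p. (\<psi> k * sqrt (e k) / sqrt (w k)) * (sqrt (w k) * u $ k))"
  proof -
    have "row A j \<bullet> u = (\<Sum>k<p. sqrt (e k) * \<psi> k * u $ k)"
      using A j u entry by (simp add: scalar_prod_def lessThan_atLeast0)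
    also have "\<dots> = (\<Sum>k<p. (\<psi> k * sqrt (e k) / sqrt (w k)) * (sqrt (w k) * u $ k))"
    proof (intro sum.cong refl)
      fix k assume "k \<in> {..<p}"
      then have "sqrt (w k) \<noteq> 0" using w[of k] by simp
      then show "sqrt (e k) * \<psi> k * u $ k = (\<psi> k * sqrt (e k) / sqrt (w k)) * (sqrt (w k) * u $ k)"
        by simp
    qed
    finally show ?thesis .
  qed
  then have "(row A j \<bullet> u)\<^sup>2 \<le> (\<Sum>k<p. (\<psi> k * sqrt (e k) / sqrt (w k))\<^sup>2) * (\<Sum>k<p. (sqrt (w k) * u $ k)\<^sup>2)"
    by (simp only: Cauchy_Schwarz_ineq_sum)
  also have "\<dots> = (\<Sum>k<p. (\<psi> k)\<^sup>2 * (e k / w k)) * (\<Sum>k<p. w k * (u $ k)\<^sup>2)"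
    using e w by (intro arg_cong2[of _ _ _ _ "(*)"] sum.cong refl)
      (auto simp: power_mult_distrib power_divide less_imp_le)
  also have "\<dots> \<le> (\<Sum>k<p. B\<^sup>2 * (e k / w k)) * (\<Sum>k<p. w k * (u $ k)\<^sup>2)"
  proof (intro mult_right_mono sum_mono)
    show "(\<psi> k)\<^sup>2 \<le> B\<^sup>2" if "k \<in> {..<p}" for k
      using power_mono[OF \<psi>, of k 2] that by simp
  qed (use e w in \<open>auto intro!: sum_nonneg divide_nonneg_nonneg simp: less_imp_le\<close>)
  finally show ?thesis by (simp add: sum_distrib_left)
qed

text \<open>In the application \<open>S\<close> is the sum of the squared predictions,
  \<open>M\<close> the same sum weighted by second derivatives of \<open>h\<close>, and
  \<open>E\<close> and \<open>P\<close> are the forms with coefficients k^(-b) and k^\<sigma>; so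
  \<open>N * E + P\<close> is the diagonal model.\<close>

lemma penalized_bounds_arith:
  fixes N E P S M :: real
  assumes N: "0 \<le> N" and E: "0 \<le> E" and P: "0 \<le> P" and c': "0 < c'" "0 < C'" and K: "0 < K"
    and a: "0 < a" "a \<le> d"
    and hi: "S \<le> N * (C' * E) + K * (C' * P)" and lo: "N * (c' * E) - K * (C' * P) \<le> S"
    and M: "a * S \<le> M" "M \<le> d * S" and S: "0 \<le> S"
  shows "min (min a (1 / (2 * K * C')) * c') (1 / 2) * (N * E + P) \<le> M + P"
    and "M + P \<le> (d * C' + d * K * C' + 1) * (N * E + P)"
proof -
  have NE: "0 \<le> N * E" using N E by simp
  have "d * S \<le> d * (N * (C' * E) + K * (C' * P))" using a hi by (intro mult_left_mono) auto
  then have "M + P \<le> d * C' * (N * E) + (d * K * C' + 1) * P" using M by (simp add: algebra_simps)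
  also have "\<dots> \<le> (d * C' + d * K * C' + 1) * (N * E) + (d * C' + d * K * C' + 1) * P"
    using a c' K by (intro add_mono mult_right_mono NE P) auto
  finally show "M + P \<le> (d * C' + d * K * C' + 1) * (N * E + P)"
    by (simp only: distrib_left)
  \<comment> \<open>Only the fraction \<open>\<epsilon>\<close> of the lower bound for \<open>M\<close> is used, so that the penalty \<open>P\<close> absorbs
    the error term of hypothesis (ii) for every \<open>N\<close>.\<close>
  define \<epsilon> where "\<epsilon> = min a (1 / (2 * K * C'))"
  have \<epsilon>: "0 < \<epsilon>" "\<epsilon> \<le> a" using a K c' by (auto simp: \<epsilon>_def)
  have "\<epsilon> * (K * C') \<le> 1 / (2 * K * C') * (K * C')"
    using K c' by (intro mult_right_mono) (auto simp: \<epsilon>_def)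
  then have \<epsilon>KC: "\<epsilon> * (K * C') \<le> 1 / 2" using K c' by simp
  have "\<epsilon> * (N * (c' * E) - K * (C' * P)) \<le> \<epsilon> * S" using \<epsilon> lo by (intro mult_left_mono) auto
  also have "\<dots> \<le> a * S" using \<epsilon> S by (intro mult_right_mono) auto
  also note M(1)
  finally have 1: "\<epsilon> * c' * (N * E) - \<epsilon> * (K * C') * P \<le> M" by (simp add: algebra_simps)
  have "\<epsilon> * (K * C') * P \<le> 1 / 2 * P" using \<epsilon>KC P by (rule mult_right_mono)
  with 1 have "\<epsilon> * c' * (N * E) + 1 / 2 * P \<le> M + P" by linarith
  moreover have "min (\<epsilon> * c') (1 / 2) * (N * E) \<le> \<epsilon> * c' * (N * E)" using NE by (intro mult_right_mono) auto
  moreover have "min (\<epsilon> * c') (1 / 2) * P \<le> 1 / 2 * P" using P by (intro mult_right_mono) auto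
  ultimately show "min (min a (1 / (2 * K * C')) * c') (1 / 2) * (N * E + P) \<le> M + P"
    unfolding distrib_left \<epsilon>_def[symmetric] by linarith
qed

text \<open>The condition \<open>lam - b \<le> \<sigma>\<close> is what makes hypothesis (ii)
  usable: k^lam e_k is at most C' k^(lam - b), so the error is at most \<open>K * C'\<close> times
  the penalty.\<close>

lemma penalized_form_bounds:
  fixes e v :: "nat \<Rightarrow> real"
  assumes ev: "\<And>k. k < p \<Longrightarrow> c' * real (Suc k) powr (- b) \<le> e k" "\<And>k. k < p \<Longrightarrow> e k \<le> C' * real (Suc k) powr (- b)"
    and c': "0 < c'" "0 < C'" and N: "0 \<le> N" and K: "0 < K" and a: "0 < a" "a \<le> d"
    and S: "\<bar>S - N * (\<Sum>k<p. e k * (v k)\<^sup>2)\<bar> \<le> K * (\<Sum>k<p. real (Suc k) powr lam * (e k * (v k)\<^sup>2))"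
    and M: "a * S \<le> M" "M \<le> d * S" and S0: "0 \<le> S" and lam: "lam - b \<le> \<sigma>"
  shows "min (min a (1 / (2 * K * C')) * c') (1 / 2) * (\<Sum>k<p. weight N b \<sigma> k * (v k)\<^sup>2)
      \<le> M + (\<Sum>k<p. real (Suc k) powr \<sigma> * (v k)\<^sup>2)" (is "?l * ?W \<le> _")
    and "M + (\<Sum>k<p. real (Suc k) powr \<sigma> * (v k)\<^sup>2)
      \<le> (d * C' + d * K * C' + 1) * (\<Sum>k<p. weight N b \<sigma> k * (v k)\<^sup>2)"
proof -
  let ?P = "\<Sum>k<p. real (Suc k) powr \<sigma> * (v k)\<^sup>2" and ?E = "\<Sum>k<p. real (Suc k) powr (- b) * (v k)\<^sup>2"
  have W: "?W = N * ?E + ?P"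
    by (simp add: weight_def distrib_right sum.distrib sum_distrib_left mult.assoc)
  have E0: "0 \<le> ?E" and P0: "0 \<le> ?P" by (auto intro!: sum_nonneg)
  have R: "(\<Sum>k<p. real (Suc k) powr lam * (e k * (v k)\<^sup>2)) \<le> C' * ?P"
    unfolding sum_distrib_left
  proof (rule sum_mono)
    fix k assume k: "k \<in> {..<p}"
    have "real (Suc k) powr lam * e k \<le> real (Suc k) powr lam * (C' * real (Suc k) powr (- b))"
      using ev k by (intro mult_left_mono) auto
    also have "\<dots> = C' * real (Suc k) powr (lam - b)"
      using powr_add[of "real (Suc k)" lam "- b"] by simp
    also have "\<dots> \<le> C' * real (Suc k) powr \<sigma>"
      using c' lam by (intro mult_left_mono powr_mono) auto
    finally have "real (Suc k) powr lam * e k * (v k)\<^sup>2 \<le> C' * real (Suc k) powr \<sigma> * (v k)\<^sup>2"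
      by (rule mult_right_mono) simp
    then show "real (Suc k) powr lam * (e k * (v k)\<^sup>2) \<le> C' * (real (Suc k) powr \<sigma> * (v k)\<^sup>2)"
      by (simp only: mult.assoc)
  qed
  then have KR: "K * (\<Sum>k<p. real (Suc k) powr lam * (e k * (v k)\<^sup>2)) \<le> K * (C' * ?P)"
    using K by (intro mult_left_mono) auto
  have lo: "c' * ?E \<le> (\<Sum>k<p. e k * (v k)\<^sup>2)" and hi: "(\<Sum>k<p. e k * (v k)\<^sup>2) \<le> C' * ?E"
    unfolding sum_distrib_left mult.assoc[symmetric] using ev
    by (auto intro!: sum_mono mult_right_mono simp del: of_nat_Suc)
  have "S \<le> N * (C' * ?E) + K * (C' * ?P)"
    using S KR mult_left_mono[OF hi N] by linarith
  moreover have "N * (c' * ?E) - K * (C' * ?P) \<le> S"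
    using S KR mult_left_mono[OF lo N] by linarith
  ultimately show "?l * ?W \<le> M + ?P" "M + ?P \<le> (d * C' + d * K * C' + 1) * ?W"
    unfolding W using penalized_bounds_arith[OF N E0 P0 c' K a _ _ M S0] by blast+
qed

section \<open>From the operator and sup norms to the design matrix\<close>

lemma sup_norm_on_le_D:
  assumes "sup_norm_on S f \<le> ereal C" "x \<in> S"
  shows "\<bar>f x\<bar> \<le> C"
proof -
  have "ereal \<bar>f x\<bar> \<le> sup_norm_on S f"
    unfolding sup_norm_on_def using assms(2) by (rule SUP_upper)
  then show ?thesis using assms(1) by (metis ereal_less_eq(3) order_trans)
qed

lemma finite_ereal_le:
  fixes x :: ereal
  assumes "x < \<infinity>"
  obtains K :: real where "0 < K" "x \<le> ereal K"
proof -
  from assms obtain n :: nat where "x < ereal (real n)" by (auto simp: less_PInf_Ex_of_nat)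
  also have "\<dots> \<le> ereal (real n + 1)" by simp
  finally have "x \<le> ereal (real n + 1)" by simp
  then show ?thesis by (intro that[of "real n + 1"]) auto
qed

text \<open>Membership in \<open>E\<close> is carried through the induction, since additivity of
  \<open>R\<close> is available on \<open>E\<close> only. The empty sum uses homogeneity with the
  scalar 0.\<close>

lemma L2_linear_op_sum:
  assumes E: "L2_subspace E" and R: "L2_linear_op E R" and \<phi>: "\<And>k. \<phi> (Suc k) \<in> E" and x: "x \<in> {0..1}"
  shows "(\<lambda>x. \<Sum>k<p. c k * \<phi> (Suc k) x) \<in> E \<and>
    R (\<lambda>x. \<Sum>k<p. c k * \<phi> (Suc k) x) x = (\<Sum>k<p. c k * R (\<phi> (Suc k)) x)"
proof (induction p)
  case 0
  have 0: "(\<lambda>x. 0) \<in> E" using E by (auto simp: L2_subspace_def)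
  have "\<forall>f\<in>E. \<forall>c. \<forall>x\<in>{0..1}. R (\<lambda>y. c * f y) x = c * R f x"
    using R by (simp add: L2_linear_op_def)
  from this[rule_format, OF 0 x, of 0] show ?case using 0 by simp
next
  case (Suc p)
  let ?f = "\<lambda>x. \<Sum>k<p. c k * \<phi> (Suc k) x" and ?g = "\<lambda>x. c p * \<phi> (Suc p) x"
  have f: "?f \<in> E" using Suc by blast
  have E_add: "\<forall>f\<in>E. \<forall>g\<in>E. (\<lambda>x. f x + g x) \<in> E" and E_smult: "\<forall>f\<in>E. \<forall>c. (\<lambda>x. c * f x) \<in> E"
    using E by (simp_all add: L2_subspace_def)
  have R_add: "\<forall>f\<in>E. \<forall>g\<in>E. \<forall>x\<in>{0..1}. R (\<lambda>y. f y + g y) x = R f x + R g x"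
    and R_smult: "\<forall>f\<in>E. \<forall>c. \<forall>x\<in>{0..1}. R (\<lambda>y. c * f y) x = c * R f x"
    using R by (simp_all add: L2_linear_op_def)
  have g: "?g \<in> E" by (rule E_smult[rule_format, OF \<phi>])
  have "(\<lambda>x. ?f x + ?g x) \<in> E" by (rule E_add[rule_format, OF f g])
  moreover have "R (\<lambda>x. ?f x + ?g x) x = R ?f x + R ?g x"
    by (rule R_add[rule_format, OF f g x])
  moreover have "R ?g x = c p * R (\<phi> (Suc p)) x"
    by (rule R_smult[rule_format, OF \<phi> x])
  ultimately show ?case using Suc by simp
qed

text \<open>This turns hypothesis (iii), a sup norm bound on a function, into a bound on the
  predictions, which are the arguments of the second derivative of \<open>h\<close>.\<close>

lemma design_mat_row:
  assumes E: "L2_subspace E" and R: "L2_linear_op E R" and \<phi>: "\<And>k. \<phi> (Suc k) \<in> E"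
    and j: "j < n" and u: "u \<in> carrier_vec p"
  shows "row (design_mat R \<phi> n p) j \<bullet> u = R (q_fun \<phi> p u) (real (Suc j) / real n)"
proof -
  have "real (Suc j) / real n \<in> {0..1}" using j by auto
  from L2_linear_op_sum[where \<phi> = \<phi> and p = p and c = "\<lambda>k. u $ k", OF E R \<phi> this]
  have "R (q_fun \<phi> p u) (real (Suc j) / real n) = (\<Sum>k<p. u $ k * R (\<phi> (Suc k)) (real (Suc j) / real n))"
    unfolding q_fun_def by blast
  then show ?thesis
    using j u by (simp add: design_mat_def scalar_prod_def lessThan_atLeast0 mult.commute)
qed

text \<open>Hypothesis (ii) thereby compares the sum of squares of a combination of the \<psi>_k
  over the design points with n times the sum of its squared coefficients.\<close>

lemma Psi_mat_form:
  assumes w: "w \<in> carrier_vec p"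
  shows "w \<bullet> ((Psi_mat \<psi> n p - real n \<cdot>\<^sub>m 1\<^sub>m p) *\<^sub>v w) =
    (\<Sum>j<n. (\<Sum>k<p. \<psi> (Suc k) (real (Suc j) / real n) * w $ k)\<^sup>2) - real n * (\<Sum>k<p. (w $ k)\<^sup>2)"
proof -
  let ?f = "\<lambda>j k. \<psi> (Suc k) (real (Suc j) / real n)"
  have "w \<bullet> ((Psi_mat \<psi> n p - real n \<cdot>\<^sub>m 1\<^sub>m p) *\<^sub>v w) =
      (\<Sum>k<p. \<Sum>l<p. w $ k * (((\<Sum>j<n. ?f j k * ?f j l) - (if k = l then real n else 0)) * w $ l))"
    using w by (auto simp: Psi_mat_def scalar_prod_def lessThan_atLeast0[symmetric] sum.atLeast1_atMost_eq
        sum_distrib_left simp del: of_nat_Suc intro!: sum.cong)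
  also have "\<dots> = (\<Sum>k<p. \<Sum>l<p. \<Sum>j<n. (?f j k * w $ k) * (?f j l * w $ l)) -
      (\<Sum>k<p. \<Sum>l<p. if l = k then real n * (w $ k)\<^sup>2 else 0)"
    unfolding sum_subtractf[symmetric]
  proof (intro sum.cong refl)
    fix k l
    have "(\<Sum>j<n. (?f j k * w $ k) * (?f j l * w $ l)) = w $ k * ((\<Sum>j<n. ?f j k * ?f j l) * w $ l)"
      unfolding sum_distrib_right sum_distrib_left by (intro sum.cong) (simp_all add: mult_ac)
    then show "w $ k * (((\<Sum>j<n. ?f j k * ?f j l) - (if k = l then real n else 0)) * w $ l) =
        (\<Sum>j<n. (?f j k * w $ k) * (?f j l * w $ l)) - (if l = k then real n * (w $ k)\<^sup>2 else 0)"
      by (auto simp: left_diff_distrib right_diff_distrib power2_eq_square)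
  qed
  also have "(\<Sum>k<p. \<Sum>l<p. \<Sum>j<n. (?f j k * w $ k) * (?f j l * w $ l)) =
      (\<Sum>j<n. \<Sum>k<p. \<Sum>l<p. (?f j k * w $ k) * (?f j l * w $ l))"
    by (simp only: sum.swap[where B = "{..<n}" and A = "{..<p}"])
  also have "\<dots> = (\<Sum>j<n. (\<Sum>k<p. ?f j k * w $ k)\<^sup>2)"
    by (simp only: sum_product power2_eq_square)
  also have "(\<Sum>k<p. \<Sum>l<p. if l = k then real n * (w $ k)\<^sup>2 else 0) = real n * (\<Sum>k<p. (w $ k)\<^sup>2)"
    by (simp add: sum_distrib_left)
  finally show ?thesis .
qed

lemma sum_powr_le:
  assumes b: "1 < b"
  shows "(\<Sum>k<p. real (Suc k) powr (- b)) \<le> 2 + 1 / (b - 1)"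
proof -
  have "(\<Sum>k<p. real (Suc k) powr (- b)) \<le> (1 + (1 + 1 / (b - 1))) * min 1 (real p)"
  proof (rule sum_head_tail_le[OF b order_refl, where B = 1])
    show "real (Suc k) powr - b \<le> 1" for k
      using powr_mono[of "- b" 0 "real (Suc k)"] b by simp
  qed (use b in auto)
  also have "\<dots> \<le> (1 + (1 + 1 / (b - 1))) * 1"
    using b by (intro mult_left_mono) auto
  finally show ?thesis by simp
qed

section \<open>Third derivatives in the weighted and the scaled Euclidean norms\<close>

context
  fixes N b c' C' B H a d c :: real and n p :: nat
    and e :: "nat \<Rightarrow> real" and \<psi> :: "nat \<Rightarrow> nat \<Rightarrow> real" and A :: "real mat" and h :: "real \<Rightarrow> real"
  assumes smooth: "\<forall>k s. (deriv ^^ k) h differentiable (at s)"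
    and H: "\<And>t. \<bar>(deriv ^^ 3) h t\<bar> \<le> H"
    and N: "N = real n" "1 \<le> n" and p: "1 \<le> p" and b: "1 < b"
    and A: "A \<in> carrier_mat n p"
    and entry: "\<And>j k. j < n \<Longrightarrow> k < p \<Longrightarrow> A $$ (j, k) = sqrt (e k) * \<psi> j k"
    and \<psi>: "\<And>j k. j < n \<Longrightarrow> k < p \<Longrightarrow> \<bar>\<psi> j k\<bar> \<le> B"
    and e: "\<And>k. 0 \<le> e k" "\<And>k. e k \<le> C' * real (Suc k) powr (- b)"
    and pos: "0 < B" "0 < C'" "0 < a" "0 < c" "0 \<le> H"
begin

text \<open>\<open>\<delta>\<close> bounds b + \<sigma> - 1 from below independently of n; it is
  there because \<sigma> = 2 \<gamma>0 moves with n and enters the constant of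
  \<open>sum_inverse_le\<close>. The pointwise bound on predictions supplies the order of the square
  root, the sum of squares only the factor 1/a.\<close>

lemma deriv3_sup_norm_weighted_le:
  assumes \<delta>: "0 < \<delta>" "\<delta> \<le> b + \<sigma> - 1"
    and D: "\<And>u. u \<in> carrier_vec p \<Longrightarrow> c * (\<Sum>k<p. weight N b \<sigma> k * (u $ k)\<^sup>2) \<le> (vnorm (D *\<^sub>v u))\<^sup>2"
      "\<And>u. u \<in> carrier_vec p \<Longrightarrow> a * (\<Sum>j<n. (row A j \<bullet> u)\<^sup>2) \<le> (vnorm (D *\<^sub>v u))\<^sup>2"
  shows "deriv3_sup_norm p D (neg_logpost h \<gamma> A Y) \<le>
    ereal (H * B * sqrt (C' / c * (2 + 1 / \<delta>)) / a * sqrt (min (N powr (1 / (b + \<sigma>))) (real p) / N))"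
proof -
  let ?\<mu> = "min (N powr (1 / (b + \<sigma>))) (real p)"
  have N1: "1 \<le> N" using N by simp
  have w: "0 < weight N b \<sigma> k" for k using N1 by (intro weight_pos) simp
  have \<mu>: "0 \<le> ?\<mu>" using N1 by auto
  define X where "X = B * sqrt (C' / c * (2 + 1 / \<delta>)) * sqrt (?\<mu> / N)"
  have X0: "0 \<le> X" using pos \<delta> N1 \<mu> by (auto simp: X_def)
  have X2: "X\<^sup>2 = B\<^sup>2 * (C' * ((2 + 1 / \<delta>) * (?\<mu> / N))) * (1 / c)"
    using pos \<delta> N1 \<mu> by (simp add: X_def power_mult_distrib mult_ac)
  have S: "(\<Sum>k<p. e k / weight N b \<sigma> k) \<le> C' * ((2 + 1 / \<delta>) * (?\<mu> / N))"
  proof -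
    have "(\<Sum>k<p. e k / weight N b \<sigma> k) \<le> (\<Sum>k<p. C' * (1 / (N + real (Suc k) powr (b + \<sigma>))))"
    proof (rule sum_mono)
      fix k
      have "e k / weight N b \<sigma> k \<le> C' * real (Suc k) powr (- b) / weight N b \<sigma> k"
        using e w[of k] by (intro divide_right_mono) auto
      then show "e k / weight N b \<sigma> k \<le> C' * (1 / (N + real (Suc k) powr (b + \<sigma>)))"
        by (simp add: weight_eq)
    qed
    also have "\<dots> \<le> C' * ((2 + 1 / (b + \<sigma> - 1)) * (?\<mu> / N))"
      unfolding sum_distrib_left[symmetric] using pos \<delta> b
      by (intro mult_left_mono sum_inverse_le[OF N1 _ _ refl]) auto
    also have "\<dots> \<le> C' * ((2 + 1 / \<delta>) * (?\<mu> / N))"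
      using pos \<delta> \<mu> N1 by (intro mult_left_mono mult_right_mono add_left_mono divide_left_mono) auto
    finally show ?thesis .
  qed
  have "deriv3_sup_norm p D (neg_logpost h \<gamma> A Y) \<le> ereal (H * X * (1 / a))"
  proof (rule deriv3_sup_norm_le[OF smooth A H X0])
    fix u :: "real vec" and j assume u: "u \<in> carrier_vec p" "vnorm (D *\<^sub>v u) = 1" and j: "j < n"
    have W: "(\<Sum>k<p. weight N b \<sigma> k * (u $ k)\<^sup>2) \<le> 1 / c"
      using D(1)[OF u(1)] u(2) pos by (simp add: pos_le_divide_eq mult.commute)
    have "(row A j \<bullet> u)\<^sup>2 \<le> B\<^sup>2 * (\<Sum>k<p. e k / weight N b \<sigma> k) * (\<Sum>k<p. weight N b \<sigma> k * (u $ k)\<^sup>2)"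
      by (rule row_scalar_prod_sq_le[OF A j, where \<psi> = "\<psi> j"]) (use entry[OF j] \<psi>[OF j] e w u in auto)
    also have "\<dots> \<le> X\<^sup>2"
      unfolding X2 using pos \<delta> \<mu> N1 w
      by (intro mult_mono S W mult_left_mono) (auto intro!: sum_nonneg mult_nonneg_nonneg less_imp_le[OF w])
    finally show "\<bar>row A j \<bullet> u\<bar> \<le> X"
      using X0 by (metis abs_le_square_iff abs_of_nonneg)
  next
    fix u :: "real vec" assume u: "u \<in> carrier_vec p" "vnorm (D *\<^sub>v u) = 1"
    show "(\<Sum>j<n. (row A j \<bullet> u)\<^sup>2) \<le> 1 / a"
      using D(2)[OF u(1)] u(2) pos by (simp add: pos_le_divide_eq mult.commute)
  qed
  then show ?thesis by (simp add: X_def mult_ac)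
qed

text \<open>Here all three factors take the pointwise bound X, of order sqrt(\<mu>^b / N), where b >
  1 makes the eigenvalues summable. The n terms add up to N X^3, of order \<mu>^(3 b / 2) / sqrt N;
  with b = 2 \<beta> this is the origin of the exponent 6 \<beta>.\<close>

lemma deriv3_sup_norm_scaled_one_le:
  assumes \<alpha>: "0 < \<alpha>" "\<alpha>\<^sup>2 \<le> \<mu> powr b / (c * N)" and \<mu>: "0 < \<mu>"
  shows "deriv3_sup_norm p ((1 / \<alpha>) \<cdot>\<^sub>m 1\<^sub>m p) (neg_logpost h \<gamma> A Y) \<le>
    ereal (H * sqrt ((B\<^sup>2 * C' * (2 + 1 / (b - 1)) / c) ^ 3) * sqrt (\<mu> powr (3 * b) / N))"
proof -
  define Q where "Q = B\<^sup>2 * C' * (2 + 1 / (b - 1)) / c"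
  have N1: "1 \<le> N" using N by simp
  have Q0: "0 \<le> Q" using pos b by (auto simp: Q_def)
  define X where "X = sqrt (Q * \<mu> powr b / N)"
  have X0: "0 \<le> X" and X2: "X\<^sup>2 = Q * \<mu> powr b / N" using Q0 N1 by (auto simp: X_def)
  have le: "(row A j \<bullet> u)\<^sup>2 \<le> X\<^sup>2" if u: "u \<in> carrier_vec p" "vnorm (((1 / \<alpha>) \<cdot>\<^sub>m 1\<^sub>m p) *\<^sub>v u) = 1" and j: "j < n" for u j
  proof -
    have "vnorm u = \<alpha>" using u \<alpha> by (simp add: vnorm_scaled_one)
    then have W: "(\<Sum>k<p. 1 * (u $ k)\<^sup>2) \<le> \<mu> powr b / (c * N)"
      using vnorm_sq_sum[OF u(1)] \<alpha> by simp
    have "(\<Sum>k<p. e k / 1) \<le> C' * (\<Sum>k<p. real (Suc k) powr (- b))"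
      unfolding sum_distrib_left using e by (intro sum_mono) auto
    also have "\<dots> \<le> C' * (2 + 1 / (b - 1))"
      using pos by (intro mult_left_mono sum_powr_le[OF b]) auto
    finally have S: "(\<Sum>k<p. e k / 1) \<le> C' * (2 + 1 / (b - 1))" .
    have "(row A j \<bullet> u)\<^sup>2 \<le> B\<^sup>2 * (\<Sum>k<p. e k / 1) * (\<Sum>k<p. 1 * (u $ k)\<^sup>2)"
      by (rule row_scalar_prod_sq_le[OF A j, where \<psi> = "\<psi> j"]) (use entry[OF j] \<psi>[OF j] e u in auto)
    also have "\<dots> \<le> B\<^sup>2 * (C' * (2 + 1 / (b - 1))) * (\<mu> powr b / (c * N))"
      using pos b by (intro mult_mono S W mult_left_mono) (auto intro!: sum_nonneg)
    also have "\<dots> = X\<^sup>2" by (simp add: X2 Q_def)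
    finally show ?thesis .
  qed
  have "deriv3_sup_norm p ((1 / \<alpha>) \<cdot>\<^sub>m 1\<^sub>m p) (neg_logpost h \<gamma> A Y) \<le> ereal (H * X * (N * X\<^sup>2))"
  proof (rule deriv3_sup_norm_le[OF smooth A H X0])
    show "\<bar>row A j \<bullet> u\<bar> \<le> X" if "u \<in> carrier_vec p" "vnorm (((1 / \<alpha>) \<cdot>\<^sub>m 1\<^sub>m p) *\<^sub>v u) = 1" "j < n" for u j
      using le[OF that] X0 by (metis abs_le_square_iff abs_of_nonneg)
    show "(\<Sum>j<n. (row A j \<bullet> u)\<^sup>2) \<le> N * X\<^sup>2"
      if "u \<in> carrier_vec p" "vnorm (((1 / \<alpha>) \<cdot>\<^sub>m 1\<^sub>m p) *\<^sub>v u) = 1" for u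
      using sum_bounded_above[of "{..<n}" "\<lambda>j. (row A j \<bullet> u)\<^sup>2" "X\<^sup>2"] le[OF that] N by simp
  qed
  also have "H * X * (N * X\<^sup>2) = H * sqrt (Q ^ 3) * sqrt (\<mu> powr (3 * b) / N)"
  proof -
    have "(X * (N * X\<^sup>2))\<^sup>2 = N\<^sup>2 * (X\<^sup>2) ^ 3" by (simp add: power_mult_distrib eval_nat_numeral)
    also have "\<dots> = Q ^ 3 * (\<mu> powr (3 * b) / N)"
    proof -
      have "\<mu> powr (3 * b) = (\<mu> powr b) ^ 3" using \<mu> by (simp add: powr_power mult.commute)
      then show ?thesis using N1 unfolding X2 by (simp add: power_mult_distrib power_divide eval_nat_numeral)
    qed
    finally have "sqrt ((X * (N * X\<^sup>2))\<^sup>2) = sqrt (Q ^ 3) * sqrt (\<mu> powr (3 * b) / N)"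
      by (simp only: real_sqrt_mult)
    moreover have "0 \<le> X * (N * X\<^sup>2)" using X0 N1 by simp
    ultimately show ?thesis by (simp add: mult.assoc)
  qed
  finally show ?thesis by (simp add: Q_def)
qed

end

subsection \<open>Uniform bounds over the design\<close>

lemma comparableI:
  assumes "0 < y" "y \<le> K1 * x" "x \<le> K2 * y" "0 < K1" "K1 \<le> K" "K2 \<le> K"
  shows "comparable K x y"
proof -
  have K: "0 < K" using assms by linarith
  have x: "0 < x" using assms(1,2,4) by (metis less_le_trans zero_less_mult_pos)
  have "y \<le> K * x" using assms(2) mult_right_mono[OF assms(5), of x] x by linarith
  moreover have "x \<le> K * y" using assms(3) mult_right_mono[OF assms(6), of y] assms(1) by linarith
  ultimately show ?thesis using K by (simp add: comparable_def pos_divide_le_eq mult.commute)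
qed

lemma second_deriv_bounds:
  fixes h :: "real \<Rightarrow> real"
  assumes smooth: "\<forall>k s. (deriv ^^ k) h differentiable (at s)" and pos: "\<forall>s. (deriv ^^ 2) h s > 0"
  obtains a d where "0 < a" "a \<le> d" "\<And>t. \<bar>t\<bar> \<le> C0 \<Longrightarrow> a \<le> (deriv ^^ 2) h t" "\<And>t. \<bar>t\<bar> \<le> C0 \<Longrightarrow> (deriv ^^ 2) h t \<le> d"
proof -
  \<comment> \<open>The absolute value keeps the interval nonempty even if \<open>C0\<close> is
    negative.\<close>
  let ?I = "{- \<bar>C0\<bar>..\<bar>C0\<bar>}"
  have cont: "continuous_on ?I ((deriv ^^ 2) h)"
    using smooth by (meson differentiable_at_withinI differentiable_imp_continuous_on differentiable_on_def)
  have I: "compact ?I" "?I \<noteq> {}" by auto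
  obtain x where x: "x \<in> ?I" "\<forall>y\<in>?I. (deriv ^^ 2) h x \<le> (deriv ^^ 2) h y"
    using continuous_attains_inf[OF I cont] by blast
  obtain z where z: "z \<in> ?I" "\<forall>y\<in>?I. (deriv ^^ 2) h y \<le> (deriv ^^ 2) h z"
    using continuous_attains_sup[OF I cont] by blast
  have t: "t \<in> ?I" if "\<bar>t\<bar> \<le> C0" for t using that by auto
  show ?thesis
  proof (rule that)
    show "0 < (deriv ^^ 2) h x" using pos by blast
    show "(deriv ^^ 2) h x \<le> (deriv ^^ 2) h z" using x z by blast
  qed (use x z t in blast)+
qed

lemma eventually_cutoff_ge:
  assumes "0 < s" "0 < T"
  shows "\<forall>\<^sub>F n in sequentially. T \<le> real n powr (1 / s)"
proof (rule eventually_mono[OF eventually_ge_at_top[of "nat \<lceil>T powr s\<rceil>"]])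
  fix n assume "nat \<lceil>T powr s\<rceil> \<le> n"
  then have "T powr s \<le> real n" by linarith
  then have "(T powr s) powr (1 / s) \<le> real n powr (1 / s)" using assms by (intro powr_mono2) auto
  then show "T \<le> real n powr (1 / s)" using assms by (simp add: powr_powr)
qed

text \<open>The estimates for fixed n, p and data. Apart from n \<ge> 1, the size of n matters only
  through \<open>lam - b \<le> g0\<close> and \<open>\<delta> \<le> b + g0 - 1\<close>. The six
  quantities below \<open>K\<close> involve neither n nor p nor the data, so one \<open>K\<close>
  can be chosen in advance.\<close>

lemma fixed_design_bounds:
  fixes A :: "real mat" and e :: "nat \<Rightarrow> real" and \<psi> :: "nat \<Rightarrow> nat \<Rightarrow> real"
  assumes smooth: "\<forall>k s. (deriv ^^ k) h differentiable (at s)"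
    and H: "\<And>t. \<bar>(deriv ^^ 3) h t\<bar> \<le> H" and H0: "0 \<le> H"
    and n: "1 \<le> n" and p: "1 \<le> p" and b: "1 < b" and \<gamma>: "1 < 2 * \<gamma>"
    and A: "A \<in> carrier_mat n p"
    and entry: "\<And>j k. j < n \<Longrightarrow> k < p \<Longrightarrow> A $$ (j, k) = sqrt (e k) * \<psi> j k"
    and \<psi>: "\<And>j k. j < n \<Longrightarrow> k < p \<Longrightarrow> \<bar>\<psi> j k\<bar> \<le> B" and B: "0 < B"
    and e: "\<And>k. c' * real (Suc k) powr (- b) \<le> e k" "\<And>k. e k \<le> C' * real (Suc k) powr (- b)"
    and c': "0 < c'" "0 < C'" and K0: "0 < K0"
    and S: "\<And>u. u \<in> carrier_vec p \<Longrightarrow> \<bar>(\<Sum>j<n. (row A j \<bullet> u)\<^sup>2) - real n * (\<Sum>k<p. e k * (u $ k)\<^sup>2)\<bar>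
        \<le> K0 * (\<Sum>k<p. real (Suc k) powr lam * (e k * (u $ k)\<^sup>2))"
    and \<theta>: "\<theta> \<in> carrier_vec p" and a: "0 < a" "a \<le> d"
    and curv: "\<And>j. j < n \<Longrightarrow> a \<le> (deriv ^^ 2) h (row A j \<bullet> \<theta>)" "\<And>j. j < n \<Longrightarrow> (deriv ^^ 2) h (row A j \<bullet> \<theta>) \<le> d"
    and m_def: "m = real n powr (1 / (b + 2 * \<gamma>))" and g0: "g0 = 2 * \<gamma> - 1 - 1 / m"
    and lam: "lam - b \<le> g0" and \<delta>: "0 < \<delta>" "\<delta> \<le> b + g0 - 1"
    and G: "sym_pos_def p G" "G ^\<^sub>m 2 = hessian (neg_logpost h \<gamma> A Y) \<theta>"
    and D: "sym_pos_def p D" "D ^\<^sub>m 2 = hessian (neg_loglik h A Y) \<theta> + diag_powr p g0"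
    and c_def: "c = min (min a (1 / (2 * K0 * C')) * c') (1 / 2)" and C_def: "C = d * C' + d * K0 * C' + 1"
    and K: "4 * C / c \<le> K" "C / c * (4 + 1 / \<delta>) \<le> K"
      "H * B * sqrt (C' / c * (2 + 1 / \<delta>)) / a \<le> K"
      "2 powr (b + 2) * (b + 1) * C / c \<le> K" "2 * 2 powr b * C / c * (2 + 1 / (2 * \<gamma> - 1)) \<le> K"
      "H * sqrt ((B\<^sup>2 * C' * (2 + 1 / (b - 1)) / c) ^ 3) \<le> K"
  shows "comparable K (eff_dim G D) (min m (real p)) \<and>
    deriv3_sup_norm p D (neg_logpost h \<gamma> A Y) \<le> ereal (K * sqrt (min (real n powr (1 / (b + g0))) (real p) / real n)) \<and>
    eff_dim G G = real p \<and>
    deriv3_sup_norm p G (neg_logpost h \<gamma> A Y) \<le> ereal (K * sqrt (min m (real p) / real n)) \<and>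
    comparable K (eff_dim G ((1 / alpha G (1\<^sub>m p)) \<cdot>\<^sub>m 1\<^sub>m p)) (min m (real p)) \<and>
    deriv3_sup_norm p ((1 / alpha G (1\<^sub>m p)) \<cdot>\<^sub>m 1\<^sub>m p) (neg_logpost h \<gamma> A Y) \<le>
      ereal (K * sqrt (min m (real p) powr (3 * b) / real n))"
proof -
  let ?M = "\<lambda>u. \<Sum>j<n. (deriv ^^ 2) h (row A j \<bullet> \<theta>) * (row A j \<bullet> u)\<^sup>2"
  let ?S = "\<lambda>u. \<Sum>j<n. (row A j \<bullet> u)\<^sup>2"
  let ?P = "\<lambda>\<sigma> u. \<Sum>k<p. real (Suc k) powr \<sigma> * (u $ k)\<^sup>2"
  let ?W = "\<lambda>\<sigma> u. \<Sum>k<p. weight (real n) b \<sigma> k * (u $ k)\<^sup>2"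
  let ?L = "hessian (neg_loglik h A Y) \<theta>"
  have N: "1 \<le> real n" using n by simp
  have c0: "0 < c" using a K0 c' by (simp add: c_def)
  have C0: "0 < C" using a K0 c' by (simp add: C_def add_nonneg_pos)
  have b0: "0 \<le> b" and bg: "1 < b + 2 * \<gamma>" and g: "0 \<le> 2 * \<gamma>" using b \<gamma> by auto
  have m1: "1 \<le> m" by (rule cutoff_ge_1[OF N b0 bg m_def])
  have "0 \<le> 1 / m" using m1 by simp
  \<comment> \<open>Since \<open>g0\<close> is at most 2 \<gamma>, both demands on \<open>g0\<close>
    pass on to 2 \<gamma>, and the same comparison serves \<open>G\<close> and
    \<open>D\<close>.\<close>
  then have g0_le: "g0 \<le> 2 * \<gamma>" "\<delta> \<le> b + 2 * \<gamma> - 1" and lam': "lam - b \<le> 2 * \<gamma>"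
    using g0 \<delta> lam by linarith+
  have e0: "0 \<le> e k" for k
  proof (rule order_trans[OF _ e(1)])
    show "0 \<le> c' * real (Suc k) powr (- b)" using c' by simp
  qed
  have Gc: "G \<in> carrier_mat p p" "transpose_mat G = G" and Dc: "D \<in> carrier_mat p p" "transpose_mat D = D"
    using G D by (auto simp: sym_pos_def_def)
  have M: "a * ?S u \<le> ?M u" "?M u \<le> d * ?S u" for u
    unfolding sum_distrib_left using curv by (auto intro!: sum_mono mult_right_mono)
  have S0: "0 \<le> ?S u" for u by (intro sum_nonneg) simp
  have Lc: "?L \<in> carrier_mat p p" using hessian_neg_loglik[OF smooth A \<theta>] by simp
  have form: "(vnorm (X *\<^sub>v u))\<^sup>2 = ?M u + ?P \<sigma> u"
    if X: "X \<in> carrier_mat p p" "transpose_mat X = X" "X ^\<^sub>m 2 = ?L + diag_powr p \<sigma>" and u: "u \<in> carrier_vec p"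
    for X u \<sigma>
  proof -
    have "(vnorm (X *\<^sub>v u))\<^sup>2 = u \<bullet> ((?L + diag_powr p \<sigma>) *\<^sub>v u)"
      unfolding X(3)[symmetric] by (rule vnorm_symmetric_sq[OF X(1,2) u])
    also have "(?L + diag_powr p \<sigma>) *\<^sub>v u = ?L *\<^sub>v u + diag_powr p \<sigma> *\<^sub>v u"
      by (rule add_mult_distrib_mat_vec[OF Lc diag_powr_carrier u])
    also have "u \<bullet> \<dots> = u \<bullet> (?L *\<^sub>v u) + u \<bullet> (diag_powr p \<sigma> *\<^sub>v u)"
      by (rule scalar_prod_add_distrib[OF u mult_mat_vec_carrier[OF Lc u] mult_mat_vec_carrier[OF diag_powr_carrier u]])
    also have "u \<bullet> (?L *\<^sub>v u) = ?M u" by (rule hessian_neg_loglik_quadratic_form[OF smooth A \<theta> u])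
    also have "u \<bullet> (diag_powr p \<sigma> *\<^sub>v u) = ?P \<sigma> u" by (rule diag_powr_quadratic_form[OF u])
    finally show ?thesis .
  qed
  have G2: "G ^\<^sub>m 2 = ?L + diag_powr p (2 * \<gamma>)"
    unfolding G(2) by (rule hessian_neg_logpost[OF smooth A \<theta>])
  note formG = form[OF Gc G2] and formD = form[OF Dc D(2)]
  have W: "c * ?W \<sigma> u \<le> ?M u + ?P \<sigma> u" "?M u + ?P \<sigma> u \<le> C * ?W \<sigma> u"
    if "lam - b \<le> \<sigma>" "u \<in> carrier_vec p" for \<sigma> u
    unfolding c_def C_def
    by (rule penalized_form_bounds[OF e c' _ K0 a S[OF that(2)] M S0 that(1)]; use n in simp)+
  have WG: "c * ?W (2 * \<gamma>) u \<le> (vnorm (G *\<^sub>v u))\<^sup>2" "(vnorm (G *\<^sub>v u))\<^sup>2 \<le> C * ?W (2 * \<gamma>) u"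
    if "u \<in> carrier_vec p" for u using W[OF lam' that] formG[OF that] by simp_all
  have WD: "c * ?W g0 u \<le> (vnorm (D *\<^sub>v u))\<^sup>2" "(vnorm (D *\<^sub>v u))\<^sup>2 \<le> C * ?W g0 u"
    if "u \<in> carrier_vec p" for u using W[OF lam that] formD[OF that] by simp_all
  have P0: "0 \<le> ?P \<sigma> u" for \<sigma> u by (intro sum_nonneg) simp
  have aG: "a * ?S u \<le> (vnorm (G *\<^sub>v u))\<^sup>2" if "u \<in> carrier_vec p" for u
    using M(1)[of u] P0[of "2 * \<gamma>" u] formG[OF that] by linarith
  have aD: "a * ?S u \<le> (vnorm (D *\<^sub>v u))\<^sup>2" if "u \<in> carrier_vec p" for u
    using M(1)[of u] P0[of g0 u] formD[OF that] by linarith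
  have le: "vnorm (D *\<^sub>v u) \<le> vnorm (G *\<^sub>v u)" if u: "u \<in> carrier_vec p" for u
  proof -
    have "?P g0 u \<le> ?P (2 * \<gamma>) u"
      using g0_le by (intro sum_mono mult_right_mono powr_mono) auto
    then have "(vnorm (D *\<^sub>v u))\<^sup>2 \<le> (vnorm (G *\<^sub>v u))\<^sup>2"
      using formG[OF u] formD[OF u] by linarith
    then show ?thesis by (rule power2_le_imp_le) (rule vnorm_nonneg)
  qed
  have P_unit: "?P \<sigma> (unit_vec p 0) = 1" for \<sigma>
  proof -
    have "?P \<sigma> (unit_vec p 0) = (\<Sum>k<p. if k = 0 then 1 else 0)"
      by (intro sum.cong) auto
    then show ?thesis using p by simp
  qed
  have "(vnorm (D *\<^sub>v unit_vec p 0))\<^sup>2 = (vnorm (G *\<^sub>v unit_vec p 0))\<^sup>2"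
    unfolding formG[OF unit_vec_carrier] formD[OF unit_vec_carrier] P_unit ..
  then have eq: "vnorm (D *\<^sub>v unit_vec p 0) = vnorm (G *\<^sub>v unit_vec p 0)"
    by (simp add: power2_eq_iff_nonneg vnorm_nonneg)
  note ctx = N b0 bg m_def p c0 C0 G(1) WG
  have \<mu>: "0 < min m (real p)" using m1 p by simp
  have mono: "x \<le> ereal (k * r) \<Longrightarrow> k \<le> K \<Longrightarrow> 0 \<le> r \<Longrightarrow> x \<le> ereal (K * r)" for x k r
    by (meson ereal_less_eq(3) mult_right_mono order_trans)
  have r0: "0 \<le> sqrt (min m (real p) / real n)" "0 \<le> sqrt (min (real n powr (1 / (b + g0))) (real p) / real n)"
    "0 \<le> sqrt (min m (real p) powr (3 * b) / real n)"
    using m1 by auto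
  have d3: "deriv3_sup_norm p X (neg_logpost h \<gamma> A Y) \<le>
      ereal (H * B * sqrt (C' / c * (2 + 1 / \<delta>)) / a * sqrt (min (real n powr (1 / (b + \<sigma>))) (real p) / real n))"
    if "\<delta> \<le> b + \<sigma> - 1" "\<And>u. u \<in> carrier_vec p \<Longrightarrow> c * ?W \<sigma> u \<le> (vnorm (X *\<^sub>v u))\<^sup>2"
      "\<And>u. u \<in> carrier_vec p \<Longrightarrow> a * ?S u \<le> (vnorm (X *\<^sub>v u))\<^sup>2" for X \<sigma>
    by (rule deriv3_sup_norm_weighted_le[OF smooth H refl n p b A entry \<psi> e0 e(2) B c'(2) a(1) c0 H0 \<delta>(1) that])
  note al = alpha_one_bounds[OF ctx g]
  have "comparable K (eff_dim G D) (min m (real p))"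
  proof (rule comparableI[OF \<mu> eff_dim_dominated[OF ctx Dc g0 WD le eq] _ K(1)])
    have "C / c * (4 + 1 / (b + 2 * \<gamma> - 1)) \<le> C / c * (4 + 1 / \<delta>)"
      using g0_le \<delta> c0 C0 by (intro mult_left_mono add_left_mono divide_left_mono) auto
    then show "C / c * (4 + 1 / (b + 2 * \<gamma> - 1)) \<le> K" using K(2) by linarith
  qed (use c0 C0 in auto)
  moreover have "deriv3_sup_norm p D (neg_logpost h \<gamma> A Y) \<le> ereal (K * sqrt (min (real n powr (1 / (b + g0))) (real p) / real n))"
    by (rule mono[OF d3[OF \<delta>(2) WD(1) aD] K(3) r0(2)])
  moreover have "eff_dim G G = real p" by (rule eff_dim_self[OF G(1) p])
  moreover have "deriv3_sup_norm p G (neg_logpost h \<gamma> A Y) \<le> ereal (K * sqrt (min m (real p) / real n))"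
    unfolding m_def by (rule mono[OF d3[OF g0_le(2) WG(1) aG] K(3) r0(1)[unfolded m_def]])
  moreover have "comparable K (eff_dim G ((1 / alpha G (1\<^sub>m p)) \<cdot>\<^sub>m 1\<^sub>m p)) (min m (real p))"
    by (rule comparableI[OF \<mu> eff_dim_scaled_one[OF ctx \<gamma>] _ K(4,5)]) (use b c0 C0 in auto)
  moreover have "deriv3_sup_norm p ((1 / alpha G (1\<^sub>m p)) \<cdot>\<^sub>m 1\<^sub>m p) (neg_logpost h \<gamma> A Y) \<le>
      ereal (K * sqrt (min m (real p) powr (3 * b) / real n))"
    by (rule mono[OF deriv3_sup_norm_scaled_one_le[OF smooth H refl n p b A entry \<psi> e0 e(2) B c'(2) a(1) c0 H0
      al(1,2) \<mu>] K(6) r0(3)])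
  ultimately show ?thesis by blast
qed

section \<open>Choice of the constants and of the threshold for n\<close>

theorem lemma3p9:
  fixes E :: "(real \<Rightarrow> real) set"
    and R Rt :: "(real \<Rightarrow> real) \<Rightarrow> real \<Rightarrow> real"
    and \<phi> :: "nat \<Rightarrow> real \<Rightarrow> real"
    and ev :: "nat \<Rightarrow> real"
    and c' C' \<beta> \<gamma> lam K\<^sub>0 C\<^sub>0 :: real
    and \<Y> :: "real set" and \<mu> :: "real measure" and h :: "real \<Rightarrow> real"
  assumes "L2_subspace E"
    and "L2_compact_op E R"
    and "L2_adjoint E R Rt"
    and "L2_complete_onb E \<phi>"
    and "\<forall>k\<ge>1. L2_eigenfunction (\<lambda>f. Rt (R f)) (ev k) (\<phi> k)"
    and "\<forall>k\<ge>1. ev (Suc k) \<le> ev k \<and> ev k > 0"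
    and "0 < c'" and "c' < C'" and "\<beta> \<ge> 0"
    and "\<forall>k\<ge>1. c' * real k powr (- 2 * \<beta>) \<le> ev k \<and> ev k \<le> C' * real k powr (- 2 * \<beta>)"
    and "exponential_family \<Y> \<mu> h"
    and "\<gamma> \<ge> 0"
    and i: "(SUP k\<in>{1..}. sup_norm_on {0..1} (psi R \<phi> ev k)) < \<infinity>"
    and ii: "K\<^sub>0 > 0"
      "\<forall>n\<ge>1. \<forall>p\<ge>1. \<forall>u\<in>carrier_vec p.
         \<bar>u \<bullet> ((Psi_mat (psi R \<phi> ev) n p - real n \<cdot>\<^sub>m 1\<^sub>m p) *\<^sub>v u)\<bar>
           \<le> K\<^sub>0 * (\<Sum>k<p. real (Suc k) powr lam * (u $ k)\<^sup>2)"
    and iv: "sup_norm_on UNIV ((deriv ^^ 3) h) < \<infinity>"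
    and "\<beta> > 1/2" and "\<gamma> > 1/2" and "2 * \<beta> + 2 * \<gamma> > max 2 (lam + 1)"
  shows "\<exists>K>0. \<forall>\<^sub>F n in sequentially. \<forall>p\<ge>1. \<forall>Y \<theta>hat DG D0.
    let A = design_mat R \<phi> n p;
        L = neg_loglik h A Y;
        f = neg_logpost h \<gamma> A Y;
        m = real n powr (1 / (2 * \<beta> + 2 * \<gamma>));
        \<gamma>0 = \<gamma> - 1/2 - 1 / (2 * m);
        m0 = real n powr (1 / (2 * \<beta> + 2 * \<gamma>0));
        DI = (1 / alpha DG (1\<^sub>m p)) \<cdot>\<^sub>m 1\<^sub>m p
    in
      (\<forall>j\<in>{1..n}. Y j \<in> \<Y>) \<longrightarrow>
      is_arg_min f (\<lambda>\<theta>. \<theta> \<in> carrier_vec p) \<theta>hat \<longrightarrow>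
      sup_norm_on {0..1} (R (q_fun \<phi> p \<theta>hat)) \<le> ereal C\<^sub>0 \<longrightarrow>
      sym_pos_def p DG \<and> DG ^\<^sub>m 2 = hessian f \<theta>hat \<longrightarrow>
      sym_pos_def p D0 \<and> D0 ^\<^sub>m 2 = hessian L \<theta>hat + diag_powr p (2 * \<gamma>0) \<longrightarrow>
      comparable K (eff_dim DG D0) (min m (real p)) \<and>
      deriv3_sup_norm p D0 f \<le> ereal (K * sqrt (min m0 (real p) / real n)) \<and>
      eff_dim DG DG = real p \<and>
      deriv3_sup_norm p DG f \<le> ereal (K * sqrt (min m (real p) / real n)) \<and>
      comparable K (eff_dim DG DI) (min m (real p)) \<and>
      deriv3_sup_norm p DI f \<le> ereal (K * sqrt (min m (real p) powr (6 * \<beta>) / real n))"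
proof -
  note E = assms(1) and onb = assms(4) and ev = assms(6) and evb = assms(10)
  have R: "L2_linear_op E R" using assms(2) by (simp add: L2_compact_op_def)
  have \<phi>: "\<And>k. \<phi> (Suc k) \<in> E" using onb by (simp add: L2_complete_onb_def)
  have smooth: "\<forall>k s. (deriv ^^ k) h differentiable (at s)" and h2: "\<forall>s. (deriv ^^ 2) h s > 0"
    using assms(11) unfolding exponential_family_def by blast+
  obtain a d where a: "0 < a" "a \<le> d"
    and curv: "\<And>t. \<bar>t\<bar> \<le> C\<^sub>0 \<Longrightarrow> a \<le> (deriv ^^ 2) h t" "\<And>t. \<bar>t\<bar> \<le> C\<^sub>0 \<Longrightarrow> (deriv ^^ 2) h t \<le> d"
    using second_deriv_bounds[OF smooth h2] by blast
  obtain H where H0: "0 < H" and H_le: "sup_norm_on UNIV ((deriv ^^ 3) h) \<le> ereal H"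
    using finite_ereal_le[OF iv] by blast
  have H: "\<And>t. \<bar>(deriv ^^ 3) h t\<bar> \<le> H" by (rule sup_norm_on_le_D[OF H_le UNIV_I])
  obtain B where B: "0 < B" and B_le: "(SUP k\<in>{1..}. sup_norm_on {0..1} (psi R \<phi> ev k)) \<le> ereal B"
    using finite_ereal_le[OF i] by blast
  have psi_le: "\<bar>psi R \<phi> ev (Suc k) x\<bar> \<le> B" if "x \<in> {0..1}" for k x
  proof (rule sup_norm_on_le_D[OF _ that])
    have "sup_norm_on {0..1} (psi R \<phi> ev (Suc k)) \<le> (SUP k\<in>{1..}. sup_norm_on {0..1} (psi R \<phi> ev k))"
      by (rule SUP_upper) simp
    then show "sup_norm_on {0..1} (psi R \<phi> ev (Suc k)) \<le> ereal B" using B_le by (rule order_trans)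
  qed
  have b: "1 < 2 * \<beta>" and \<gamma>: "1 < 2 * \<gamma>" using \<open>\<beta> > 1/2\<close> \<open>\<gamma> > 1/2\<close> by auto
  have s: "2 < 2 * \<beta> + 2 * \<gamma>" "lam + 1 < 2 * \<beta> + 2 * \<gamma>"
    using \<open>2 * \<beta> + 2 * \<gamma> > max 2 (lam + 1)\<close> by auto
  \<comment> \<open>The quantity 2 \<beta> + 2 \<gamma>0 - 1 is 2 \<delta> - 1/m. Half of its limit
    is kept as the uniform lower bound, the other half is spent on 1/m.\<close>
  define \<delta> where "\<delta> = (2 * \<beta> + 2 * \<gamma> - 2) / 2"
  \<comment> \<open>The second member is the room in lam - 2 \<beta> \<le> 2 \<gamma>0; both demands
    on \<gamma>0 hold as soon as 1/m \<le> \<rho>.\<close>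
  define \<rho> where "\<rho> = min \<delta> (2 * \<beta> + 2 * \<gamma> - 1 - lam)"
  have \<delta>: "0 < \<delta>" and \<rho>: "0 < \<rho>" using s by (auto simp: \<delta>_def \<rho>_def)
  have C': "0 < C'" using assms(7,8) by linarith
  define c where "c = min (min a (1 / (2 * K\<^sub>0 * C')) * c') (1 / 2)"
  define C where "C = d * C' + d * K\<^sub>0 * C' + 1"
  define Ks where "Ks = [4 * C / c, C / c * (4 + 1 / \<delta>), H * B * sqrt (C' / c * (2 + 1 / \<delta>)) / a,
    2 powr (2 * \<beta> + 2) * (2 * \<beta> + 1) * C / c, 2 * 2 powr (2 * \<beta>) * C / c * (2 + 1 / (2 * \<gamma> - 1)),
    H * sqrt ((B\<^sup>2 * C' * (2 + 1 / (2 * \<beta> - 1)) / c) ^ 3)]"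
  \<comment> \<open>Fixed before n, p and the data are introduced; the additional entry 1 makes
    \<open>K\<close> positive.\<close>
  define K where "K = Max (set (1 # Ks))"
  have "k \<le> K" if "k \<in> set (1 # Ks)" for k
    unfolding K_def by (rule Max_ge[OF finite_set that])
  then have K: "1 \<le> K" "4 * C / c \<le> K" "C / c * (4 + 1 / \<delta>) \<le> K"
    "H * B * sqrt (C' / c * (2 + 1 / \<delta>)) / a \<le> K"
    "2 powr (2 * \<beta> + 2) * (2 * \<beta> + 1) * C / c \<le> K"
    "2 * 2 powr (2 * \<beta>) * C / c * (2 + 1 / (2 * \<gamma> - 1)) \<le> K"
    "H * sqrt ((B\<^sup>2 * C' * (2 + 1 / (2 * \<beta> - 1)) / c) ^ 3) \<le> K"
    unfolding Ks_def set_simps by blast+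
  have K0: "0 < K" using K(1) by linarith
  have large: "\<forall>\<^sub>F n in sequentially. 1 \<le> n \<and> 1 / \<rho> \<le> real n powr (1 / (2 * \<beta> + 2 * \<gamma>))"
    using s \<rho> by (intro eventually_conj eventually_ge_at_top eventually_cutoff_ge) auto
  show ?thesis
  proof (intro exI[of _ K] conjI K0, rule eventually_mono[OF large], goal_cases)
    case (1 n)
    let ?m = "real n powr (1 / (2 * \<beta> + 2 * \<gamma>))"
    let ?g0 = "2 * (\<gamma> - 1 / 2 - 1 / (2 * ?m))"
    from 1 have n: "1 \<le> n" and m: "1 / \<rho> \<le> ?m" by auto
    have g0: "?g0 = 2 * \<gamma> - 1 - 1 / ?m" by (simp add: algebra_simps)
    have "0 < ?m" using n by simp
    then have "1 / ?m \<le> \<rho>" using m \<rho> by (simp add: pos_divide_le_eq mult.commute)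
    then have "1 / ?m \<le> \<delta>" "1 / ?m \<le> 2 * \<beta> + 2 * \<gamma> - 1 - lam"
      unfolding \<rho>_def by linarith+
    moreover have "2 * \<delta> = 2 * \<beta> + 2 * \<gamma> - 2" by (simp add: \<delta>_def)
    ultimately have lam: "lam - 2 * \<beta> \<le> ?g0" and \<delta>_le: "\<delta> \<le> 2 * \<beta> + ?g0 - 1"
      unfolding g0 by linarith+
    show ?case
      unfolding Let_def
    proof (intro allI impI, goal_cases)
      case (1 p Y \<theta>hat DG D0)
      let ?A = "design_mat R \<phi> n p"
      let ?e = "\<lambda>k. ev (Suc k)" and ?\<psi> = "\<lambda>j k. psi R \<phi> ev (Suc k) (real (Suc j) / real n)"
      have p: "1 \<le> p" and \<theta>: "\<theta>hat \<in> carrier_vec p" and G: "sym_pos_def p DG" "DG ^\<^sub>m 2 = hessian (neg_logpost h \<gamma> ?A Y) \<theta>hat"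
        and D: "sym_pos_def p D0" "D0 ^\<^sub>m 2 = hessian (neg_loglik h ?A Y) \<theta>hat + diag_powr p ?g0"
        and sup: "sup_norm_on {0..1} (R (q_fun \<phi> p \<theta>hat)) \<le> ereal C\<^sub>0"
        using 1 unfolding is_arg_min_def by blast+
      have x: "real (Suc j) / real n \<in> {0..1}" if "j < n" for j using that by auto
      have A: "?A \<in> carrier_mat n p" by (simp add: design_mat_def)
      have entry: "?A $$ (j, k) = sqrt (?e k) * ?\<psi> j k" if "j < n" "k < p" for j k
        using that ev[rule_format, of "Suc k"] by (simp add: design_mat_def psi_def)
      have \<psi>: "\<bar>?\<psi> j k\<bar> \<le> B" if "j < n" "k < p" for j k by (rule psi_le[OF x[OF that(1)]])
      have e: "c' * real (Suc k) powr (- (2 * \<beta>)) \<le> ?e k" "?e k \<le> C' * real (Suc k) powr (- (2 * \<beta>))" for k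
        using evb[rule_format, of "Suc k"] by simp_all
      have row: "\<bar>row ?A j \<bullet> \<theta>hat\<bar> \<le> C\<^sub>0" if "j < n" for j
        unfolding design_mat_row[where \<phi> = \<phi>, OF E R \<phi> that \<theta>] by (rule sup_norm_on_le_D[OF sup x[OF that]])
      have S: "\<bar>(\<Sum>j<n. (row ?A j \<bullet> u)\<^sup>2) - real n * (\<Sum>k<p. ?e k * (u $ k)\<^sup>2)\<bar>
          \<le> K\<^sub>0 * (\<Sum>k<p. real (Suc k) powr lam * (?e k * (u $ k)\<^sup>2))" if u: "u \<in> carrier_vec p" for u
      proof -
        \<comment> \<open>Since R \<phi>_k is sqrt(ev k) times \<psi>_k, these are the coordinates
          of R q with respect to the \<psi>_k; hypothesis (ii) is applied to them.\<close>
        define w where "w = vec p (\<lambda>k. sqrt (?e k) * u $ k)"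
        have w: "w \<in> carrier_vec p" by (simp add: w_def)
        have w2: "(w $ k)\<^sup>2 = ?e k * (u $ k)\<^sup>2" if "k < p" for k
          using that ev[rule_format, of "Suc k"] by (simp add: w_def power_mult_distrib)
        have "row ?A j \<bullet> u = (\<Sum>k<p. ?\<psi> j k * w $ k)" if "j < n" for j
          using that u entry[OF that] A
          by (simp add: scalar_prod_def lessThan_atLeast0 w_def mult_ac del: of_nat_Suc)
        then have "(\<Sum>j<n. (row ?A j \<bullet> u)\<^sup>2) = (\<Sum>j<n. (\<Sum>k<p. ?\<psi> j k * w $ k)\<^sup>2)"
          by (intro sum.cong) auto
        moreover have "(\<Sum>k<p. (w $ k)\<^sup>2) = (\<Sum>k<p. ?e k * (u $ k)\<^sup>2)"
          by (intro sum.cong) (auto simp: w2)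
        moreover have "(\<Sum>k<p. real (Suc k) powr lam * (w $ k)\<^sup>2) = (\<Sum>k<p. real (Suc k) powr lam * (?e k * (u $ k)\<^sup>2))"
          by (intro sum.cong) (auto simp: w2)
        ultimately show ?thesis
          using ii(2)[rule_format, OF n p w] unfolding Psi_mat_form[OF w] by (simp only:)
      qed
      have six: "3 * (2 * \<beta>) = 6 * \<beta>" by simp
      show ?case
        by (rule fixed_design_bounds[where A = ?A and e = ?e and \<psi> = ?\<psi>, OF smooth H less_imp_le[OF H0] n p b \<gamma> A entry \<psi> B e
            assms(7) C' ii(1) S \<theta> a curv(1)[OF row] curv(2)[OF row] refl g0 lam \<delta> \<delta>_le G D c_def C_def K(2-7), unfolded six])
    qed
  qed
qed

end
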